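(* Let $R$ be a Noetherian commutative ring with identity. Then $cl(\mathbb{AG}(R))$ is finite if and only if for every ideal $I$ of $R$ with $I^2=(0)$, $I$ has a finite number of $R$-submodules.
   Context: An ideal $I$ of $R$ is an annihilating-ideal if $\mathrm{Ann}(I)\neq(0)$, i.e. there is a nonzero ideal $J$ of $R$ with $IJ=(0)$. The annihilating-ideal graph $\mathbb{AG}(R)$ is the undirected simple graph whose vertices are the nonzero annihilating-ideals of $R$, where two distinct vertices $I,J$ are adjacent if and only if $IJ=(0)$. For a graph $G$, $cl(G)$ is the clique number (number of vertices in a largest complete subgraph; infinite if the sizes of complete subgraphs are not bounded by a finite number). *)

theory Defs
  imports
    "HOL-Algebra.Module"
    "HOL-Algebra.Ideal_Product"
    "HOL-Algebra.Ring_Divisibility"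
    "HOL-Library.Extended_Nat"
    "HOL-Library.Ramsey"
begin

definition annihilator :: "('a, 'b) ring_scheme \<Rightarrow> 'a set \<Rightarrow> 'a set" where
  "annihilator R I = {r \<in> carrier R. \<forall>x\<in>I. r \<otimes>\<^bsub>R\<^esub> x = \<zero>\<^bsub>R\<^esub>}"

definition annihilating_ideal :: "('a, 'b) ring_scheme \<Rightarrow> 'a set \<Rightarrow> bool" where
  "annihilating_ideal R I \<longleftrightarrow> ideal I R \<and> annihilator R I \<noteq> {\<zero>\<^bsub>R\<^esub>}"

definition AG_verts :: "('a, 'b) ring_scheme \<Rightarrow> 'a set set" where
  "AG_verts R = {I. annihilating_ideal R I \<and> I \<noteq> {\<zero>\<^bsub>R\<^esub>}}"

definition AG_edges :: "('a, 'b) ring_scheme \<Rightarrow> 'a set set set" where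
  "AG_edges R = {{I, J} | I J. I \<in> AG_verts R \<and> J \<in> AG_verts R \<and> I \<noteq> J
                               \<and> I \<cdot>\<^bsub>R\<^esub> J = {\<zero>\<^bsub>R\<^esub>}}"

text \<open>
  The clique number of the simple graph with vertex set \<open>V\<close> and edge set \<open>E\<close>. The supremum is
  taken in \<^typ>\<open>enat\<close>, so it is \<open>\<infinity>\<close> exactly when the sizes of the finite complete subgraphs are
  unbounded; since an infinite complete subgraph has complete subgraphs of every finite size,
  restricting to finite ones loses nothing. (\<^const>\<open>clique\<close> alone does not require \<open>K \<subseteq> V\<close>.)
\<close>
definition clique_number :: "'v set \<Rightarrow> 'v set set \<Rightarrow> enat" where
  "clique_number V E = (SUP K \<in> {K. K \<subseteq> V \<and> finite K \<and> clique K E}. enat (card K))"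

text \<open>
  An ideal as an \<open>R\<close>-module. The fields \<open>mult\<close> and \<open>one\<close> are only there because the module record
  extends the ring record; modules and submodules do not refer to them.
\<close>
definition ideal_module :: "('a, 'b) ring_scheme \<Rightarrow> 'a set \<Rightarrow> ('a, 'a) module" where
  "ideal_module R I = \<lparr>carrier = I, monoid.mult = (\<otimes>\<^bsub>R\<^esub>), one = \<one>\<^bsub>R\<^esub>, zero = \<zero>\<^bsub>R\<^esub>,
                       add = (\<oplus>\<^bsub>R\<^esub>), smult = (\<otimes>\<^bsub>R\<^esub>)\<rparr>"

lemma (in cring) annihilating_ideal_iff:
  "annihilating_ideal R I \<longleftrightarrow>
     ideal I R \<and> (\<exists>J. ideal J R \<and> J \<noteq> {\<zero>} \<and> I \<cdot> J = {\<zero>})"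
proof (cases "ideal I R")
  case True
  then interpret I: ideal I R .
  have ann: "ideal (annihilator R I) R"
  proof (rule idealI)
    show "ring R" by (rule ring_axioms)
    have minus: "(\<ominus> a) \<otimes> x = \<zero>" if "a \<in> carrier R" "x \<in> I" "a \<otimes> x = \<zero>" for a x
      using that l_minus[of a x] I.Icarr by simp
    show "subgroup (annihilator R I) (add_monoid R)"
    proof (rule add.subgroupI)
      show "annihilator R I \<subseteq> carrier R" by (auto simp: annihilator_def)
      have "\<zero> \<in> annihilator R I" by (simp add: annihilator_def I.Icarr)
      then show "annihilator R I \<noteq> {}" by blast
      show "\<ominus> a \<in> annihilator R I" if "a \<in> annihilator R I" for a
        using that by (simp add: annihilator_def minus)
      show "a \<oplus> b \<in> annihilator R I" if "a \<in> annihilator R I" "b \<in> annihilator R I" for a b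
        using that by (simp add: annihilator_def l_distr I.Icarr)
    qed
    show l: "x \<otimes> a \<in> annihilator R I" if "a \<in> annihilator R I" "x \<in> carrier R" for a x
      using that by (auto simp: annihilator_def m_assoc I.Icarr)
    show "a \<otimes> x \<in> annihilator R I" if "a \<in> annihilator R I" "x \<in> carrier R" for a x
      using l[OF that] that by (simp add: annihilator_def m_comm)
  qed
  have z: "\<zero> \<in> X" if "ideal X R" for X
    by (rule additive_subgroup.zero_closed[OF ideal.axioms(1)[OF that]])
  have 1: "I \<cdot> annihilator R I = {\<zero>}"
  proof
    show "I \<cdot> annihilator R I \<subseteq> {\<zero>}"
    proof
      fix s assume "s \<in> I \<cdot> annihilator R I"
      then show "s \<in> {\<zero>}"
      proof (induction rule: ideal_prod.induct)
        case (prod i r)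
        then have "i \<otimes> r = r \<otimes> i" by (intro m_comm) (auto simp: annihilator_def I.Icarr)
        with prod show ?case by (simp add: annihilator_def)
      qed simp
    qed
    show "{\<zero>} \<subseteq> I \<cdot> annihilator R I"
      using z[OF ideal_prod_is_ideal[OF True ann]] by simp
  qed
  have 2: "J \<subseteq> annihilator R I" if J: "ideal J R" "I \<cdot> J = {\<zero>}" for J
  proof
    fix x assume x: "x \<in> J"
    then have xR: "x \<in> carrier R" by (rule ideal.Icarr[OF J(1)])
    moreover have "x \<otimes> i = \<zero>" if i: "i \<in> I" for i
      using ideal_prod.prod[OF i x, of R] J(2) m_comm[OF xR I.Icarr[OF i]] by simp
    ultimately show "x \<in> annihilator R I" by (simp add: annihilator_def)
  qed
  show ?thesis
  proof
    assume "annihilating_ideal R I"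
    then show "ideal I R \<and> (\<exists>J. ideal J R \<and> J \<noteq> {\<zero>} \<and> I \<cdot> J = {\<zero>})"
      using ann 1 by (auto simp: annihilating_ideal_def)
  next
    assume "ideal I R \<and> (\<exists>J. ideal J R \<and> J \<noteq> {\<zero>} \<and> I \<cdot> J = {\<zero>})"
    then obtain J where J: "ideal J R" "J \<noteq> {\<zero>}" "I \<cdot> J = {\<zero>}" by blast
    have "annihilator R I \<noteq> {\<zero>}"
      using 2[OF J(1,3)] J(2) z[OF J(1)] by (metis empty_iff subset_singletonD)
    with True show "annihilating_ideal R I" by (simp add: annihilating_ideal_def)
  qed
next
  case False
  then show ?thesis by (simp add: annihilating_ideal_def)
qed

lemma (in cring) ideal_module_is_module:
  assumes "ideal I R"
  shows "module R (ideal_module R I)"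
proof -
  interpret I: ideal I R by fact
  show ?thesis
  proof (rule moduleI)
    show "abelian_group (ideal_module R I)"
    proof (rule abelian_groupI)
      fix x assume x: "x \<in> carrier (ideal_module R I)"
      then show "\<exists>y \<in> carrier (ideal_module R I).
          y \<oplus>\<^bsub>ideal_module R I\<^esub> x = \<zero>\<^bsub>ideal_module R I\<^esub>"
        by (intro bexI[of _ "\<ominus> x"]) (auto simp: ideal_module_def l_neg I.Icarr)
    qed (auto simp: ideal_module_def I.Icarr a_ac)
  qed (auto simp: ideal_module_def I.Icarr l_distr r_distr m_assoc I.I_l_closed is_cring)
qed

end

theory Submission
  imports Defs
begin

text \<open>
  Any two ideals inside an ideal \<open>I\<close> with \<open>I\<^sup>2 = 0\<close> have product zero, so the nonzero ones form a
  complete subgraph; a finite clique number therefore leaves only finitely many ideals below \<open>I\<close>.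

  For the converse, the difficulty is uniformity: the hypothesis gives a finite number for each \<open>I\<close>
  separately, and there may be infinitely many square-zero ideals. (In
  \<open>\<complex>[x,y,z]/(xy, xz, yz, x\<^sup>2 - y\<^sup>2, x\<^sup>2 - z\<^sup>2)\<close> every isotropic vector of a ternary quadratic form
  gives one.) The uniform control comes from lengths. A Noetherian ring has a largest ideal \<open>L\<close> of
  finite length, and under the hypothesis \<open>L\<close> contains every nilpotent element \<open>x\<close>
  (\<open>nilpotent_finite_length\<close>): by induction on the nilpotency exponent \<open>Rx\<^sup>2\<close> has finite length, the
  ideal \<open>x Ann(x\<^sup>2)\<close> has square zero and hence finite length, and multiplication by \<open>x\<close> identifies
  the quotient \<open>Rx / x Ann(x\<^sup>2)\<close> with \<open>Rx\<^sup>2\<close>.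

  The members of a clique then fall into three groups.

  \<^item> Ideals not inside \<open>L\<close> contain non-nilpotent elements, and these are orthogonal for distinct
    members. A Noetherian ring bounds the size of such families
    (\<open>bounded_orthogonal_non_nilpotents\<close>).
  \<^item> Ideals inside \<open>L\<close> with nonzero square: none lies in the sum of others, because they would
    annihilate it. Adding them one at a time gives a strict chain below \<open>L\<close>, so their number is at
    most the length of \<open>L\<close> (\<open>square_nonzero_clique_bound\<close>).
  \<^item> Ideals inside \<open>L\<close> with zero square have a sum \<open>S\<close> with \<open>S\<^sup>2 = 0\<close>, so they are among the finitely
    many ideals below \<open>S\<close>. That number is bounded independently of \<open>S\<close>
    (\<open>bounded_finite_intervals\<close>): from an ideal \<open>J\<close> one climbs through an ideal \<open>T\<close> with \<open>T/J\<close>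
    simple, say \<open>T/J \<cong> R/m\<close>. Only finitely many maximal ideals \<open>m\<close> occur below \<open>L\<close>. If \<open>R/m\<close> is
    infinite, two choices of \<open>T\<close> would span a plane with infinitely many lines, contrary to
    finiteness; if \<open>R/m\<close> is finite, there are at most \<open>|R/m|\<^sup>l\<close> choices, where \<open>l\<close> is the length of
    \<open>L\<close>. The number of steps is at most \<open>l\<close> as well.

  Quotient modules are avoided throughout: a subquotient \<open>B/A\<close> appears as the interval of ideals
  between \<open>A\<close> and \<open>B\<close>.
\<close>
no_notation Sum_Type.Plus (infixr \<open><+>\<close> 65)

section \<open>Arithmetic of ideals\<close>

lemma ideal_zero_mem: "ideal I R \<Longrightarrow> \<zero>\<^bsub>R\<^esub> \<in> I"
  by (rule additive_subgroup.zero_closed[OF ideal.axioms(1)])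

lemma ideal_add_mem: "ideal I R \<Longrightarrow> a \<in> I \<Longrightarrow> b \<in> I \<Longrightarrow> a \<oplus>\<^bsub>R\<^esub> b \<in> I"
  by (rule additive_subgroup.a_closed[OF ideal.axioms(1)])

lemma ideal_diff_mem: "ideal I R \<Longrightarrow> a \<in> I \<Longrightarrow> b \<in> I \<Longrightarrow> a \<ominus>\<^bsub>R\<^esub> b \<in> I"
  unfolding a_minus_def
  by (intro ideal_add_mem) (auto intro: additive_subgroup.a_inv_closed[OF ideal.axioms(1)])

lemma ideal_sub_carrier: "ideal I R \<Longrightarrow> I \<subseteq> carrier R"
  by (auto intro: ideal.Icarr)

lemma (in ring) ideal_sum_upper:
  assumes "ideal I R" "ideal J R"
  shows "I \<subseteq> I <+> J" "J \<subseteq> I <+> J"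
  using genideal_self[of "I \<union> J"] union_genideal[OF assms] assms
  by (auto dest: ideal_sub_carrier)

lemma (in ring) ideal_sum_least:
  assumes "ideal K R" "I \<subseteq> K" "J \<subseteq> K"
  shows "I <+> J \<subseteq> K"
  using assms by (auto simp: set_add_def' intro: ideal_add_mem)

lemma (in cring) ideal_sum_principal_iff:
  assumes "ideal I R" "x \<in> carrier R"
  shows "z \<in> I <+> PIdl x \<longleftrightarrow> (\<exists>i\<in>I. \<exists>r\<in>carrier R. z = i \<oplus> r \<otimes> x)"
  by (auto simp: set_add_def' cgenideal_def)

lemma (in cring) ideal_sum_principal:
  assumes "ideal I R" "x \<in> carrier R"
  shows "ideal (I <+> PIdl x) R" "I \<subseteq> I <+> PIdl x" "x \<in> I <+> PIdl x"
  using add_ideals[OF assms(1) cgenideal_ideal[OF assms(2)]] cgenideal_self[OF assms(2)]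
    ideal_sum_upper[OF assms(1) cgenideal_ideal[OF assms(2)]] by auto

lemma (in ring) ideal_sum_principal_least:
  assumes "ideal K R" "I \<subseteq> K" "x \<in> K"
  shows "I <+> PIdl x \<subseteq> K"
  by (intro ideal_sum_least[OF assms(1,2)] cgenideal_minimal[OF assms(1,3)])

lemma (in ring) ideal_prod_eq_zero_iff:
  assumes "ideal I R" "ideal J R"
  shows "I \<cdot> J = {\<zero>} \<longleftrightarrow> (\<forall>i\<in>I. \<forall>j\<in>J. i \<otimes> j = \<zero>)"
proof
  assume 0: "\<forall>i\<in>I. \<forall>j\<in>J. i \<otimes> j = \<zero>"
  have "s = \<zero>" if "s \<in> I \<cdot> J" for s
    using that 0 by (induction rule: ideal_prod.induct) auto
  then show "I \<cdot> J = {\<zero>}"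
    using ideal_zero_mem[OF ideal_prod_is_ideal[OF assms]] by blast
next
  assume "I \<cdot> J = {\<zero>}"
  then show "\<forall>i\<in>I. \<forall>j\<in>J. i \<otimes> j = \<zero>"
    using ideal_prod.prod[of _ I _ J R] by simp
qed

definition colon :: "('a, 'b) ring_scheme \<Rightarrow> 'a set \<Rightarrow> 'a set \<Rightarrow> 'a set" where
  "colon R A B = {r \<in> carrier R. \<forall>x\<in>B. r \<otimes>\<^bsub>R\<^esub> x \<in> A}"

lemma (in cring) colon_ideal:
  assumes A: "ideal A R" and B: "B \<subseteq> carrier R"
  shows "ideal (colon R A B) R"
proof (rule idealI)
  show "ring R" by (rule ring_axioms)
  note BC = subsetD[OF B]
  have inv: "(\<ominus> a) \<otimes> x \<in> A" if "a \<in> carrier R" "x \<in> B" "a \<otimes> x \<in> A" for a x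
    using that l_minus[of a x] BC additive_subgroup.a_inv_closed[OF ideal.axioms(1)[OF A]]
    by simp
  show "subgroup (colon R A B) (add_monoid R)"
  proof (rule add.subgroupI)
    show "colon R A B \<noteq> {}"
      using BC ideal_zero_mem[OF A] by (auto simp: colon_def intro!: exI[of _ \<zero>])
  qed (auto simp: colon_def BC l_distr inv intro: ideal_add_mem[OF A])
  show l: "x \<otimes> a \<in> colon R A B" if "a \<in> colon R A B" "x \<in> carrier R" for a x
    using that by (auto simp: colon_def m_assoc BC intro: ideal.I_l_closed[OF A])
  show "a \<otimes> x \<in> colon R A B" if "a \<in> colon R A B" "x \<in> carrier R" for a x
    using l[OF that] that by (simp add: colon_def m_comm)
qed

lemma (in cring) annihilator_ideal:
  assumes "S \<subseteq> carrier R"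
  shows "ideal (annihilator R S) R"
proof -
  have "annihilator R S = colon R {\<zero>} S"
    by (simp add: annihilator_def colon_def)
  then show ?thesis
    using colon_ideal[OF zeroideal assms] by simp
qed

text \<open>
  Annihilators are ideals, so orthogonality passes from generators to the generated ideals, one
  factor after the other.
\<close>
lemma (in cring) genideal_mult_zero:
  assumes S: "S \<subseteq> carrier R" and T: "T \<subseteq> carrier R"
    and st: "\<And>s t. s \<in> S \<Longrightarrow> t \<in> T \<Longrightarrow> s \<otimes> t = \<zero>"
    and s: "s \<in> Idl S" and t: "t \<in> Idl T"
  shows "s \<otimes> t = \<zero>"
proof -
  have "Idl S \<subseteq> annihilator R T"
    by (rule genideal_minimal[OF annihilator_ideal[OF T]]) (use S st in \<open>auto simp: annihilator_def\<close>)
  then have s': "s \<in> carrier R" "s \<in> annihilator R T"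
    using s by (auto simp: annihilator_def)
  have "Idl T \<subseteq> annihilator R {s}"
    by (rule genideal_minimal[OF annihilator_ideal])
      (use T s' in \<open>auto simp: annihilator_def m_comm subset_iff\<close>)
  then show ?thesis
    using t s'(1) m_comm by (auto simp: annihilator_def)
qed

text \<open>
  The maximal condition, by Zorn: the union of a chain of ideals is a member of the chain.
\<close>
lemma (in noetherian_ring) exists_maximal_in:
  assumes "F \<noteq> {}" "\<And>I. I \<in> F \<Longrightarrow> ideal I R"
  shows "\<exists>M\<in>F. \<forall>X\<in>F. M \<subseteq> X \<longrightarrow> X = M"
proof (rule subset_Zorn_nonempty[OF assms(1)])
  fix C assume C: "C \<noteq> {}" "subset.chain F C"
  then have "subset.chain {I. ideal I R} C"
    using assms(2) by (auto simp: pred_on.chain_def)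
  then have "\<Union>C \<in> C"
    using ideal_chain_is_trivial[OF C(1)] by blast
  then show "\<Union>C \<in> F"
    using C(2) by (auto simp: pred_on.chain_def)
qed

section \<open>Intervals of finite length in the lattice of ideals\<close>

definition ideal_interval :: "('a, 'b) ring_scheme \<Rightarrow> 'a set \<Rightarrow> 'a set \<Rightarrow> 'a set set" where
  "ideal_interval R A B = {X. ideal X R \<and> A \<subseteq> X \<and> X \<subseteq> B}"

text \<open>
  Finite length of \<open>B/A\<close> is witnessed by any strictly increasing function into the natural numbers,
  not only by the length function itself. This makes length arguments short: a rank on one interval
  is pulled back along a strictly increasing map from another.
\<close>
definition rank_function ::
    "('a, 'b) ring_scheme \<Rightarrow> 'a set \<Rightarrow> 'a set \<Rightarrow> ('a set \<Rightarrow> nat) \<Rightarrow> bool" where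
  "rank_function R A B \<rho> \<longleftrightarrow> strict_mono_on (ideal_interval R A B) \<rho>"

definition finite_length :: "('a, 'b) ring_scheme \<Rightarrow> 'a set \<Rightarrow> 'a set \<Rightarrow> bool" where
  "finite_length R A B \<longleftrightarrow> (\<exists>\<rho>. rank_function R A B \<rho>)"

lemma rank_functionI:
  assumes "\<And>X Y. ideal X R \<Longrightarrow> ideal Y R \<Longrightarrow> A \<subseteq> X \<Longrightarrow> X \<subset> Y \<Longrightarrow> Y \<subseteq> B \<Longrightarrow> \<rho> X < \<rho> Y"
  shows "rank_function R A B \<rho>"
  using assms by (auto simp: rank_function_def ideal_interval_def strict_mono_on_def)

lemma rank_function_less:
  assumes "rank_function R A B \<rho>" "ideal X R" "ideal Y R" "A \<subseteq> X" "X \<subset> Y" "Y \<subseteq> B"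
  shows "\<rho> X < \<rho> Y"
proof (rule strict_mono_onD[of "ideal_interval R A B"])
  show "strict_mono_on (ideal_interval R A B) \<rho>"
    using assms(1) by (simp add: rank_function_def)
  show "X \<in> ideal_interval R A B" "Y \<in> ideal_interval R A B"
    using assms by (auto simp: ideal_interval_def)
qed fact

lemma rank_function_le:
  assumes "rank_function R A B \<rho>" "ideal X R" "ideal Y R" "A \<subseteq> X" "X \<subseteq> Y" "Y \<subseteq> B"
  shows "\<rho> X \<le> \<rho> Y"
proof (cases "X = Y")
  case False
  then have "X \<subset> Y" using assms(5) by blast
  then show ?thesis using rank_function_less[OF assms(1-4) _ assms(6)] by simp
qed simp

lemma rank_function_subinterval:
  assumes "rank_function R A B \<rho>" "A \<subseteq> A'" "B' \<subseteq> B"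
  shows "rank_function R A' B' \<rho>"
proof (rule rank_functionI)
  fix X Y assume "ideal X R" "ideal Y R" "A' \<subseteq> X" "X \<subset> Y" "Y \<subseteq> B'"
  then show "\<rho> X < \<rho> Y"
    using assms by (intro rank_function_less[OF assms(1)]) auto
qed

lemma finite_interval_imp_finite_length:
  assumes fin: "finite (ideal_interval R A B)"
  shows "finite_length R A B"
  unfolding finite_length_def
proof (intro exI rank_functionI)
  fix X Y assume XY: "ideal X R" "ideal Y R" "A \<subseteq> X" "X \<subset> Y" "Y \<subseteq> B"
  show "card (ideal_interval R A X) < card (ideal_interval R A Y)"
  proof (rule psubset_card_mono)
    show "finite (ideal_interval R A Y)"
      by (rule finite_subset[OF _ fin]) (use XY in \<open>auto simp: ideal_interval_def\<close>)
    show "ideal_interval R A X \<subset> ideal_interval R A Y"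
    proof
      show "ideal_interval R A X \<subseteq> ideal_interval R A Y"
        using XY(4) by (auto simp: ideal_interval_def)
      have "Y \<in> ideal_interval R A Y" "Y \<notin> ideal_interval R A X"
        using XY by (auto simp: ideal_interval_def)
      then show "ideal_interval R A X \<noteq> ideal_interval R A Y"
        by metis
    qed
  qed
qed

text \<open>
  The form in which the modular law enters: if \<open>y = x + b\<close>, then \<open>b = y - x\<close> lies in \<open>Y \<inter> B\<close>, so in \<open>X\<close>.
\<close>
lemma (in ring) modular_cancel:
  assumes B: "ideal B R" and X: "ideal X R" and Y: "ideal Y R" and "X \<subseteq> Y"
    and int: "Y \<inter> B \<subseteq> X" and sum: "Y \<subseteq> X <+> B"
  shows "X = Y"
proof
  show "Y \<subseteq> X"
  proof
    fix y assume y: "y \<in> Y"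
    then obtain x b where xb: "x \<in> X" "b \<in> B" "y = x \<oplus> b"
      using sum by (auto simp: set_add_def')
    then have c: "x \<in> carrier R" "b \<in> carrier R"
      using X B ideal.Icarr by fast+
    then have "b = y \<ominus> x"
      using xb(3) by algebra
    then have "b \<in> Y"
      using ideal_diff_mem[OF Y] y xb(1) \<open>X \<subseteq> Y\<close> by blast
    then show "y \<in> X"
      using xb int ideal_add_mem[OF X] by blast
  qed
qed fact

text \<open>
  By the modular law \<open>X \<mapsto> (X \<inter> B, X + B)\<close> is strictly increasing, so ranks below and above \<open>B\<close>
  add up to a rank on the whole interval.
\<close>
lemma (in ring) finite_length_trans:
  assumes A: "ideal A R" and B: "ideal B R" and C: "ideal C R" and sub: "A \<subseteq> B" "B \<subseteq> C"
    and "finite_length R A B" "finite_length R B C"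
  shows "finite_length R A C"
proof -
  obtain \<rho> \<sigma> where \<rho>: "rank_function R A B \<rho>" and \<sigma>: "rank_function R B C \<sigma>"
    using assms(6,7) by (auto simp: finite_length_def)
  have "rank_function R A C (\<lambda>X. \<rho> (X \<inter> B) + \<sigma> (X <+> B))"
  proof (rule rank_functionI)
    fix X Y assume XY: "ideal X R" "ideal Y R" "A \<subseteq> X" "X \<subset> Y" "Y \<subseteq> C"
    note ids = i_intersect[OF XY(1) B] i_intersect[OF XY(2) B]
      add_ideals[OF XY(1) B] add_ideals[OF XY(2) B]
    have up: "X \<subseteq> X <+> B" "B \<subseteq> X <+> B" "Y \<subseteq> Y <+> B" "B \<subseteq> Y <+> B"
      using ideal_sum_upper[OF XY(1) B] ideal_sum_upper[OF XY(2) B] by auto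
    have s: "X <+> B \<subseteq> Y <+> B" "Y <+> B \<subseteq> C"
      using ideal_sum_least[OF ids(4), of X B] ideal_sum_least[OF C, of Y B] up XY sub by auto
    have i: "X \<inter> B \<subseteq> Y \<inter> B" "A \<subseteq> X \<inter> B" "Y \<inter> B \<subseteq> B"
      using XY sub by auto
    have "X \<inter> B \<noteq> Y \<inter> B \<or> X <+> B \<noteq> Y <+> B"
      using modular_cancel[OF B XY(1,2)] XY(4) up(3) by blast
    then show "\<rho> (X \<inter> B) + \<sigma> (X <+> B) < \<rho> (Y \<inter> B) + \<sigma> (Y <+> B)"
    proof
      assume "X \<inter> B \<noteq> Y \<inter> B"
      then have "\<rho> (X \<inter> B) < \<rho> (Y \<inter> B)"
        using rank_function_less[OF \<rho> ids(1,2)] i by blast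
      moreover have "\<sigma> (X <+> B) \<le> \<sigma> (Y <+> B)"
        by (rule rank_function_le[OF \<sigma> ids(3,4) up(2) s])
      ultimately show ?thesis by simp
    next
      assume "X <+> B \<noteq> Y <+> B"
      then have "\<sigma> (X <+> B) < \<sigma> (Y <+> B)"
        using rank_function_less[OF \<sigma> ids(3,4) up(2) _ s(2)] s(1) by blast
      moreover have "\<rho> (X \<inter> B) \<le> \<rho> (Y \<inter> B)"
        by (rule rank_function_le[OF \<rho> ids(1,2) i(2,1,3)])
      ultimately show ?thesis by simp
    qed
  qed
  then show ?thesis
    by (auto simp: finite_length_def)
qed

text \<open>
  The second isomorphism theorem, \<open>(A + B)/A \<cong> B/(A \<inter> B)\<close>: intersecting with \<open>B\<close> is strictly
  increasing between \<open>A\<close> and \<open>A + B\<close>, so the rank of \<open>B\<close> bounds the upper interval.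
\<close>
lemma (in ring) finite_length_sum:
  assumes A: "ideal A R" and B: "ideal B R"
    and flA: "finite_length R {\<zero>} A" and "finite_length R {\<zero>} B"
  shows "finite_length R {\<zero>} (A <+> B)"
proof (rule finite_length_trans[OF zeroideal A add_ideals[OF A B] _ _ flA])
  show "{\<zero>} \<subseteq> A" "A \<subseteq> A <+> B"
    using ideal_zero_mem[OF A] ideal_sum_upper[OF A B] by auto
  obtain \<rho> where \<rho>: "rank_function R {\<zero>} B \<rho>"
    using assms(4) by (auto simp: finite_length_def)
  have "rank_function R A (A <+> B) (\<lambda>X. \<rho> (X \<inter> B))"
  proof (rule rank_functionI)
    fix X Y assume XY: "ideal X R" "ideal Y R" "A \<subseteq> X" "X \<subset> Y" "Y \<subseteq> A <+> B"
    note ids = i_intersect[OF XY(1) B] i_intersect[OF XY(2) B]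
    have "Y \<subseteq> X <+> B"
      using XY ideal_sum_least[OF add_ideals[OF XY(1) B], of A B] ideal_sum_upper[OF XY(1) B]
      by blast
    then have "X \<inter> B \<subset> Y \<inter> B"
      using modular_cancel[OF B XY(1,2)] XY(4) by blast
    then show "\<rho> (X \<inter> B) < \<rho> (Y \<inter> B)"
      using rank_function_less[OF \<rho> ids] ideal_zero_mem[OF ids(1)] by blast
  qed
  then show "finite_length R A (A <+> B)"
    by (auto simp: finite_length_def)
qed

section \<open>Nilpotent elements generate ideals of finite length\<close>

text \<open>
  Multiplication by \<open>x\<close> maps \<open>Rx\<close> onto \<open>Rx\<^sup>2\<close> with kernel \<open>{sx | s x\<^sup>2 = 0}\<close>, which is \<open>Z\<close>. So \<open>Rx/Z\<close> is
  isomorphic to \<open>Rx\<^sup>2\<close>, and the rank of an ideal \<open>X\<close> between \<open>Z\<close> and \<open>Rx\<close> may be read off from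
  its image \<open>xX\<close>.
\<close>
lemma (in cring) finite_length_principal_step:
  assumes x: "x \<in> carrier R" and fl: "finite_length R {\<zero>} (PIdl (x \<otimes> x))"
  defines "Z \<equiv> {s \<otimes> x | s. s \<in> annihilator R {x \<otimes> x}}"
  shows "ideal Z R" "Z \<subseteq> PIdl x" "finite_length R Z (PIdl x)"
proof -
  let ?N = "annihilator R {x \<otimes> x}"
  have N: "ideal ?N R"
    using x by (intro annihilator_ideal) auto
  have NC: "s \<in> carrier R" if "s \<in> ?N" for s
    using that ideal.Icarr[OF N] by blast
  show Z: "ideal Z R"
  proof (rule idealI[OF ring_axioms])
    show "subgroup Z (add_monoid R)"
    proof (rule add.subgroupI)
      show "Z \<subseteq> carrier R" "Z \<noteq> {}"
        using x NC ideal_zero_mem[OF N] by (auto simp: Z_def)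
      fix a b assume ab: "a \<in> Z" "b \<in> Z"
      then obtain s t where st: "s \<in> ?N" "t \<in> ?N" "a = s \<otimes> x" "b = t \<otimes> x"
        by (auto simp: Z_def)
      then show "a \<oplus> b \<in> Z"
        unfolding Z_def using ideal_add_mem[OF N st(1,2)] NC x by (auto simp: l_distr intro!: exI[of _ "s \<oplus> t"])
      show "\<ominus> a \<in> Z"
        unfolding Z_def using additive_subgroup.a_inv_closed[OF ideal.axioms(1)[OF N] st(1)] NC st x
        by (auto simp: l_minus intro!: exI[of _ "\<ominus> s"])
    qed
    show l: "r \<otimes> a \<in> Z" if a: "a \<in> Z" and r: "r \<in> carrier R" for a r
    proof -
      obtain s where s: "s \<in> ?N" "a = s \<otimes> x" using a by (auto simp: Z_def)
      show ?thesis
        unfolding Z_def using ideal.I_l_closed[OF N s(1) r] NC s r x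
        by (auto simp: m_assoc intro!: exI[of _ "r \<otimes> s"])
    qed
    show "a \<otimes> r \<in> Z" if a: "a \<in> Z" and r: "r \<in> carrier R" for a r
      using l[OF that] a r x NC by (auto simp: Z_def m_comm)
  qed
  show "Z \<subseteq> PIdl x"
    using NC by (auto simp: Z_def cgenideal_def)
  obtain \<rho> where \<rho>: "rank_function R {\<zero>} (PIdl (x \<otimes> x)) \<rho>"
    using fl by (auto simp: finite_length_def)
  have img: "ideal ((\<lambda>y. x \<otimes> y) ` X) R" if X: "ideal X R" for X
  proof (rule idealI[OF ring_axioms])
    note XC = ideal.Icarr[OF X]
    show "subgroup ((\<lambda>y. x \<otimes> y) ` X) (add_monoid R)"
    proof (rule add.subgroupI)
      show "(\<lambda>y. x \<otimes> y) ` X \<subseteq> carrier R" "(\<lambda>y. x \<otimes> y) ` X \<noteq> {}"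
        using x XC ideal_zero_mem[OF X] by auto
      fix a b assume ab: "a \<in> (\<lambda>y. x \<otimes> y) ` X" "b \<in> (\<lambda>y. x \<otimes> y) ` X"
      then obtain s t where st: "s \<in> X" "t \<in> X" "a = x \<otimes> s" "b = x \<otimes> t"
        by auto
      then show "a \<oplus> b \<in> (\<lambda>y. x \<otimes> y) ` X"
        using ideal_add_mem[OF X st(1,2)] XC x by (auto simp: r_distr intro!: image_eqI[of _ _ "s \<oplus> t"])
      show "\<ominus> a \<in> (\<lambda>y. x \<otimes> y) ` X"
        using additive_subgroup.a_inv_closed[OF ideal.axioms(1)[OF X] st(1)] XC st x
        by (auto simp: r_minus intro!: image_eqI[of _ _ "\<ominus> s"])
    qed
    show l: "a \<otimes> r \<in> (\<lambda>y. x \<otimes> y) ` X" if "a \<in> (\<lambda>y. x \<otimes> y) ` X" "r \<in> carrier R" for a r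
      using that x XC ideal.I_r_closed[OF X]
      by (auto simp: m_assoc intro!: image_eqI[OF _ ideal.I_r_closed[OF X]])
    show "r \<otimes> a \<in> (\<lambda>y. x \<otimes> y) ` X" if "a \<in> (\<lambda>y. x \<otimes> y) ` X" "r \<in> carrier R" for a r
      using l[OF that] that x XC by (auto simp: m_comm)
  qed
  have "rank_function R Z (PIdl x) (\<lambda>X. \<rho> ((\<lambda>y. x \<otimes> y) ` X))"
  proof (rule rank_functionI)
    fix X Y assume XY: "ideal X R" "ideal Y R" "Z \<subseteq> X" "X \<subset> Y" "Y \<subseteq> PIdl x"
    have "Y \<subseteq> X" if eq: "(\<lambda>y. x \<otimes> y) ` Y \<subseteq> (\<lambda>y. x \<otimes> y) ` X"
    proof
      fix y assume y: "y \<in> Y"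
      then obtain z where z: "z \<in> X" "x \<otimes> y = x \<otimes> z"
        using eq by blast
      have "y \<in> PIdl x" "z \<in> PIdl x"
        using y z(1) XY(4,5) by auto
      then obtain s t where s: "s \<in> carrier R" "y = s \<otimes> x" and t: "t \<in> carrier R" "z = t \<otimes> x"
        by (auto simp: cgenideal_def)
      have "(s \<ominus> t) \<otimes> (x \<otimes> x) = x \<otimes> y \<ominus> x \<otimes> z"
        unfolding s(2) t(2) using s(1) t(1) x by algebra
      also have "\<dots> = \<zero>"
        using z s t x by (simp add: a_minus_def r_neg)
      finally have "(s \<ominus> t) \<otimes> x \<in> Z"
        using s t by (auto simp: Z_def annihilator_def)
      then have "(s \<ominus> t) \<otimes> x \<oplus> z \<in> X"
        using XY(3) z(1) ideal_add_mem[OF XY(1)] by blast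
      moreover have "(s \<ominus> t) \<otimes> x \<oplus> z = y"
        unfolding s(2) t(2) using s(1) t(1) x by algebra
      ultimately show "y \<in> X" by simp
    qed
    then have 1: "(\<lambda>y. x \<otimes> y) ` X \<subset> (\<lambda>y. x \<otimes> y) ` Y"
      using XY(4) by blast
    have 2: "(\<lambda>y. x \<otimes> y) ` Y \<subseteq> PIdl (x \<otimes> x)"
      using XY(5) x by (fastforce simp: cgenideal_def m_lcomm)
    show "\<rho> ((\<lambda>y. x \<otimes> y) ` X) < \<rho> ((\<lambda>y. x \<otimes> y) ` Y)"
      using rank_function_less[OF \<rho> img[OF XY(1)] img[OF XY(2)] _ 1 2]
        ideal_zero_mem[OF img[OF XY(1)]] by blast
  qed
  then show "finite_length R Z (PIdl x)"
    by (auto simp: finite_length_def)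
qed

text \<open>
  If \<open>x\<^sup>n = 0\<close> with \<open>n \<le> 2\<close>, then \<open>Rx\<close> itself has square zero. Otherwise \<open>x\<^sup>2\<close> has a smaller exponent,
  about \<open>n/2\<close>, and the kernel \<open>Z\<close> of multiplication by \<open>x\<close> on \<open>Rx\<close> has square zero:
  \<open>(sx)(tx) = t(sx\<^sup>2) = 0\<close> when \<open>s\<close> kills \<open>x\<^sup>2\<close>.
\<close>
lemma (in cring) nilpotent_finite_length:
  assumes sq: "\<And>I. ideal I R \<Longrightarrow> I \<cdot> I = {\<zero>} \<Longrightarrow> finite_length R {\<zero>} I"
    and "x \<in> carrier R" "x [^] (n::nat) = \<zero>"
  shows "finite_length R {\<zero>} (PIdl x)"
  using assms(2,3)
proof (induction n arbitrary: x rule: less_induct)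
  case (less n)
  note x = less.prems(1)
  show ?case
  proof (cases "n \<le> 2")
    case True
    then have "x [^] (2::nat) = \<zero>"
      using less.prems nat_pow_mult[OF x, of n "2 - n"] by simp
    then have xx: "x \<otimes> x = \<zero>"
      using x by (simp add: numeral_2_eq_2)
    have "(a \<otimes> x) \<otimes> (b \<otimes> x) = (a \<otimes> b) \<otimes> (x \<otimes> x)" if "a \<in> carrier R" "b \<in> carrier R" for a b
      using that x by algebra
    then have "(PIdl x) \<cdot> (PIdl x) = {\<zero>}"
      unfolding ideal_prod_eq_zero_iff[OF cgenideal_ideal[OF x] cgenideal_ideal[OF x]]
      using x xx by (auto simp: cgenideal_def)
    then show ?thesis
      by (rule sq[OF cgenideal_ideal[OF x]])
  next
    case False
    \<comment> \<open>\<open>k = \<lceil>n/2\<rceil>\<close>, so that \<open>(x\<^sup>2)\<^sup>k = 0\<close>; it is smaller than \<open>n\<close> because \<open>n \<ge> 3\<close>.\<close>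
    define k where "k = (n + 1) div 2"
    have "k < n" "n \<le> 2 * k"
      using False by (auto simp: k_def)
    have "(x \<otimes> x) [^] k = x [^] k \<otimes> x [^] k"
      using x by (simp add: nat_pow_distrib)
    also have "\<dots> = x [^] (2 * k)"
      using x by (simp add: nat_pow_mult mult_2)
    also have "\<dots> = x [^] n \<otimes> x [^] (2 * k - n)"
      using nat_pow_mult[OF x, of n "2 * k - n"] \<open>n \<le> 2 * k\<close> by simp
    finally have "(x \<otimes> x) [^] k = \<zero>"
      using less.prems by simp
    then have fl: "finite_length R {\<zero>} (PIdl (x \<otimes> x))"
      using less.IH[OF \<open>k < n\<close>, of "x \<otimes> x"] x by simp
    define Z where "Z = {s \<otimes> x | s. s \<in> annihilator R {x \<otimes> x}}"
    note Z = finite_length_principal_step[OF x fl, folded Z_def]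
    have *: "(s \<otimes> x) \<otimes> (t \<otimes> x) = \<zero>"
      if "s \<in> annihilator R {x \<otimes> x}" "t \<in> annihilator R {x \<otimes> x}" for s t
    proof -
      have c: "s \<in> carrier R" "t \<in> carrier R" and 0: "s \<otimes> (x \<otimes> x) = \<zero>"
        using that by (auto simp: annihilator_def)
      have "(s \<otimes> x) \<otimes> (t \<otimes> x) = t \<otimes> (s \<otimes> (x \<otimes> x))"
        using c x by algebra
      then show ?thesis using 0 c by simp
    qed
    have "Z \<cdot> Z = {\<zero>}"
      unfolding ideal_prod_eq_zero_iff[OF Z(1) Z(1)] using * by (auto simp: Z_def)
    then have "finite_length R {\<zero>} Z"
      by (rule sq[OF Z(1)])
    then show ?thesis
      using finite_length_trans[OF zeroideal Z(1) cgenideal_ideal[OF x] _ Z(2) _ Z(3)]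
        ideal_zero_mem[OF Z(1)] by simp
  qed
qed

section \<open>Simple subquotients\<close>

definition covers :: "('a, 'b) ring_scheme \<Rightarrow> 'a set \<Rightarrow> 'a set \<Rightarrow> bool" where
  "covers R J T \<longleftrightarrow> ideal J R \<and> ideal T R \<and> J \<subset> T \<and>
     (\<forall>X. ideal X R \<longrightarrow> J \<subseteq> X \<longrightarrow> X \<subseteq> T \<longrightarrow> X = J \<or> X = T)"

lemma covers_ideals:
  assumes "covers R J T"
  shows "ideal J R" "ideal T R" "J \<subseteq> T" "J \<noteq> T"
  using assms unfolding covers_def by auto

lemma covers_between:
  assumes "covers R J T" "ideal X R" "J \<subseteq> X" "X \<subseteq> T"
  shows "X = J \<or> X = T"
  using assms unfolding covers_def by auto

text \<open>
  A cover of \<open>J\<close> below \<open>B\<close> is found as an ideal of least rank strictly above \<open>J\<close>.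
\<close>
lemma exists_cover:
  assumes \<rho>: "rank_function R J B \<rho>" and JB: "ideal J R" "ideal B R" "J \<subset> B"
  shows "\<exists>T. covers R J T \<and> T \<subseteq> B"
proof -
  let ?P = "\<lambda>T. ideal T R \<and> J \<subset> T \<and> T \<subseteq> B"
  have "?P B" using JB by simp
  then obtain T where T: "?P T" and least: "\<And>Y. ?P Y \<Longrightarrow> \<rho> T \<le> \<rho> Y"
    using ex_has_least_nat[of ?P B \<rho>] by auto
  have "X = J \<or> X = T" if X: "ideal X R" "J \<subseteq> X" "X \<subseteq> T" for X
  proof (rule ccontr)
    assume "\<not> (X = J \<or> X = T)"
    then have "J \<subset> X" "X \<subset> T" using X by auto
    then have "\<rho> X < \<rho> T"
      using rank_function_less[OF \<rho> X(1), of T] T X by simp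
    then show False
      using least[of X] X T \<open>J \<subset> X\<close> by auto
  qed
  then show ?thesis
    using T JB by (auto simp: covers_def)
qed

lemma (in cring) cover_eq_principal:
  assumes c: "covers R J T" and x: "x \<in> T" "x \<notin> J"
  shows "J <+> PIdl x = T"
proof -
  note i = covers_ideals[OF c]
  have xc: "x \<in> carrier R" using ideal.Icarr[OF i(2) x(1)] .
  note p = ideal_sum_principal[OF i(1) xc]
  show ?thesis
    using covers_between[OF c p(1,2) ideal_sum_principal_least[OF i(2,3) x(1)]] p(3) x(2) by auto
qed

text \<open>
  Any \<open>x \<in> T - J\<close> generates \<open>T\<close> modulo \<open>J\<close>, so \<open>(J : T)\<close> is already \<open>(J : x)\<close>.
\<close>
lemma (in cring) cover_colonI:
  assumes c: "covers R J T" and x: "x \<in> T" "x \<notin> J" and r: "r \<in> carrier R" "r \<otimes> x \<in> J"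
  shows "r \<in> colon R J T"
proof -
  note i = covers_ideals[OF c]
  have xc: "x \<in> carrier R" using ideal.Icarr[OF i(2) x(1)] .
  have "r \<otimes> t \<in> J" if t: "t \<in> T" for t
  proof -
    obtain j s where js: "j \<in> J" "s \<in> carrier R" "t = j \<oplus> s \<otimes> x"
      using t cover_eq_principal[OF c x] ideal_sum_principal_iff[OF i(1) xc] by auto
    have jc: "j \<in> carrier R" using ideal.Icarr[OF i(1) js(1)] .
    have "r \<otimes> t = r \<otimes> j \<oplus> s \<otimes> (r \<otimes> x)"
      unfolding js(3) using jc js(2) r(1) xc by algebra
    then show ?thesis
      using ideal_add_mem[OF i(1) ideal.I_l_closed[OF i(1) js(1) r(1)]
          ideal.I_l_closed[OF i(1) r(2) js(2)]] by simp
  qed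
  then show ?thesis using r by (simp add: colon_def)
qed

text \<open>
  The simple module \<open>T/J\<close> is \<open>R/(J : T)\<close>. If \<open>r\<close> does not send \<open>T\<close> into \<open>J\<close>, then some \<open>rt\<close> generates
  \<open>T\<close> modulo \<open>J\<close>, so \<open>t \<equiv> s(rt)\<close> for some \<open>s\<close>, and \<open>s\<close> is an inverse of \<open>r\<close> modulo \<open>(J : T)\<close>.
\<close>
lemma (in cring) cover_colon_maximal:
  assumes c: "covers R J T"
  shows "maximalideal (colon R J T) R"
proof (rule maximalidealI)
  note i = covers_ideals[OF c]
  show "ideal (colon R J T) R"
    by (rule colon_ideal[OF i(1) ideal_sub_carrier[OF i(2)]])
  obtain x where x: "x \<in> T" "x \<notin> J" using i by auto
  have "\<one> \<notin> colon R J T"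
    using x ideal.Icarr[OF i(2)] by (auto simp: colon_def)
  then show "carrier R \<noteq> colon R J T" by auto
  fix K assume K: "ideal K R" "colon R J T \<subseteq> K" "K \<subseteq> carrier R"
  show "K = colon R J T \<or> K = carrier R"
  proof (cases "K = colon R J T")
    case False
    then obtain r where r: "r \<in> K" "r \<notin> colon R J T" using K by auto
    then have rc: "r \<in> carrier R" using K by auto
    then obtain t where t: "t \<in> T" "r \<otimes> t \<notin> J" using r by (auto simp: colon_def)
    have tc: "t \<in> carrier R" using ideal.Icarr[OF i(2) t(1)] .
    have rt: "r \<otimes> t \<in> T" "r \<otimes> t \<in> carrier R"
      using ideal.I_l_closed[OF i(2) t(1) rc] rc tc by auto
    have tJ: "t \<notin> J" using t(2) ideal.I_l_closed[OF i(1) _ rc] by auto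
    obtain j s where js: "j \<in> J" "s \<in> carrier R" "t = j \<oplus> s \<otimes> (r \<otimes> t)"
      using t(1) cover_eq_principal[OF c rt(1) t(2)] ideal_sum_principal_iff[OF i(1) rt(2)] by auto
    have jc: "j \<in> carrier R" using ideal.Icarr[OF i(1) js(1)] .
    have "(\<one> \<ominus> s \<otimes> r) \<otimes> t = t \<ominus> s \<otimes> (r \<otimes> t)"
      using js(2) rc tc by algebra
    also have "\<dots> = (j \<oplus> s \<otimes> (r \<otimes> t)) \<ominus> s \<otimes> (r \<otimes> t)"
      using js(3) by simp
    also have "\<dots> = j"
      using jc js(2) rc tc by algebra
    finally have "\<one> \<ominus> s \<otimes> r \<in> colon R J T"
      using cover_colonI[OF c t(1) tJ] js rc by simp
    then have "(\<one> \<ominus> s \<otimes> r) \<oplus> s \<otimes> r \<in> K"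
      using K(2) ideal_add_mem[OF K(1) _ ideal.I_l_closed[OF K(1) r(1) js(2)]] by auto
    moreover have "(\<one> \<ominus> s \<otimes> r) \<oplus> s \<otimes> r = \<one>"
      using js(2) rc by algebra
    ultimately show ?thesis
      using ideal.one_imp_carrier[OF K(1)] by simp
  qed simp
qed

text \<open>
  This finiteness will show that only finitely many residue fields occur inside an ideal of finite
  length. If \<open>T\<close> covers \<open>A\<close>, then \<open>(A : T)(T : B) \<subseteq> (A : B)\<close>, and a maximal ideal over \<open>(A : B)\<close>, being
  prime, contains one of the factors. It equals the maximal ideal \<open>(A : T)\<close> or falls under the
  induction hypothesis for the shorter interval from \<open>T\<close> to \<open>B\<close>.
\<close>
lemma (in cring) finite_maximal_over_colon:
  assumes "rank_function R A B \<rho>" "ideal A R" "ideal B R" "A \<subseteq> B"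
  shows "finite {p. maximalideal p R \<and> colon R A B \<subseteq> p}"
  using assms
proof (induction "\<rho> B - \<rho> A" arbitrary: A rule: less_induct)
  case less
  note \<rho> = less.prems(1) and A = less.prems(2) and B = less.prems(3)
  show ?case
  proof (cases "A = B")
    case True
    have "colon R B B = carrier R"
      using ideal.I_l_closed[OF B] by (auto simp: colon_def)
    then have "{p. maximalideal p R \<and> colon R A B \<subseteq> p} = {}"
      using True maximalideal.I_notcarr ideal_sub_carrier[OF maximalideal.axioms(1)] by fastforce
    then show ?thesis by (simp only: finite.emptyI)
  next
    case False
    then obtain T where c: "covers R A T" and TB: "T \<subseteq> B"
      using exists_cover[OF \<rho> A B] less.prems(4) by auto
    note i = covers_ideals[OF c]
    have "\<rho> A < \<rho> T" "\<rho> T \<le> \<rho> B"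
      using rank_function_less[OF \<rho> A i(2)] rank_function_le[OF \<rho> i(2) B i(3) TB] i TB by auto
    then have fin: "finite {p. maximalideal p R \<and> colon R T B \<subseteq> p}"
      using less.hyps[of T] rank_function_subinterval[OF \<rho> i(3)] i(2) B TB by auto
    have "p = colon R A T \<or> colon R T B \<subseteq> p" if p: "maximalideal p R" "colon R A B \<subseteq> p" for p
    proof (rule disjCI)
      assume "\<not> colon R T B \<subseteq> p"
      then obtain s where s: "s \<in> colon R T B" "s \<notin> p" by auto
      have "r \<in> p" if r: "r \<in> colon R A T" for r
      proof -
        have rs: "r \<in> carrier R" "s \<in> carrier R" using r s by (auto simp: colon_def)
        have "r \<otimes> s \<in> colon R A B"
          using r s ideal.Icarr[OF B] by (auto simp: colon_def m_assoc)
        then show ?thesis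
          using primeideal.I_prime[OF maximalideal_prime[OF p(1)] rs] p(2) s(2) by auto
      qed
      then have "colon R A T \<subseteq> p" by auto
      then show "p = colon R A T"
        using maximalideal.I_maximal[OF cover_colon_maximal[OF c] maximalideal.axioms(1)[OF p(1)]]
          ideal_sub_carrier[OF maximalideal.axioms(1)[OF p(1)]] maximalideal.I_notcarr[OF p(1)]
        by auto
    qed
    then have "{p. maximalideal p R \<and> colon R A B \<subseteq> p}
        \<subseteq> insert (colon R A T) {p. maximalideal p R \<and> colon R T B \<subseteq> p}"
      by auto
    then show ?thesis
      using fin finite_subset by auto
  qed
qed

section \<open>Bounding the size of finite intervals\<close>

definition finite_subinterval :: "('a, 'b) ring_scheme \<Rightarrow> 'a set \<Rightarrow> 'a set \<Rightarrow> 'a set \<Rightarrow> bool" where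
  "finite_subinterval R L J S \<longleftrightarrow>
     ideal J R \<and> ideal S R \<and> J \<subseteq> S \<and> S \<subseteq> L \<and> finite (ideal_interval R J S)"

lemma finite_subintervalD:
  assumes "finite_subinterval R L J S"
  shows "ideal J R" "ideal S R" "J \<subseteq> S" "S \<subseteq> L" "finite (ideal_interval R J S)"
  using assms unfolding finite_subinterval_def by auto

text \<open>
  A finite set that meets every residue class modulo \<open>m\<close>; classes may be met more than once, so its
  existence just says that \<open>R/m\<close> is finite.
\<close>
definition residue_system :: "('a, 'b) ring_scheme \<Rightarrow> 'a set \<Rightarrow> 'a set \<Rightarrow> bool" where
  "residue_system R m C \<longleftrightarrow>
     finite C \<and> C \<subseteq> carrier R \<and> (\<forall>r\<in>carrier R. \<exists>c\<in>C. r \<ominus>\<^bsub>R\<^esub> c \<in> m)"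

text \<open>
  Pick \<open>x\<close> and \<open>x'\<close> that generate \<open>T\<close> and \<open>T'\<close> modulo \<open>J\<close>. Both \<open>T/J\<close> and \<open>T'/J\<close> are copies of the
  field \<open>k = R/m\<close>, they are independent because \<open>T \<inter> T' = J\<close>, and the lines spanned by \<open>x + rx'\<close>
  for \<open>r\<close> in \<open>k\<close> are distinct. As only finitely many ideals lie between \<open>J\<close> and \<open>S\<close>, the field \<open>k\<close>
  is finite.
\<close>
lemma (in cring) two_covers_imp_finite_residue:
  assumes c: "covers R J T" and c': "covers R J T'" and ne: "T \<noteq> T'"
    and eq: "colon R J T' = colon R J T"
    and S: "ideal S R" "T \<subseteq> S" "T' \<subseteq> S" and fin: "finite (ideal_interval R J S)"
  shows "\<exists>C. residue_system R (colon R J T) C"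
proof -
  note i = covers_ideals[OF c] and i' = covers_ideals[OF c']
  note J = i(1)
  let ?m = "colon R J T"
  have m: "ideal ?m R"
    by (rule colon_ideal[OF J ideal_sub_carrier[OF i(2)]])
  have TT': "T \<inter> T' = J"
    using covers_between[OF c i_intersect[OF i(2) i'(2)]]
      covers_between[OF c' i_intersect[OF i(2) i'(2)]] i i' ne by auto
  obtain x x' where x: "x \<in> T" "x \<notin> J" and x': "x' \<in> T'" "x' \<notin> J"
    using i i' by auto
  have xc: "x \<in> carrier R" "x' \<in> carrier R"
    using ideal.Icarr[OF i(2) x(1)] ideal.Icarr[OF i'(2) x'(1)] by auto
  define f where "f = (\<lambda>r. J <+> PIdl (x \<oplus> r \<otimes> x'))"
  have "f r \<in> ideal_interval R J S" if r: "r \<in> carrier R" for r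
  proof -
    have "x \<oplus> r \<otimes> x' \<in> S"
      using x x' S by (intro ideal_add_mem[OF S(1)] ideal.I_l_closed[OF S(1)] r) auto
    then show ?thesis
      using ideal_sum_principal_least[OF S(1), of J "x \<oplus> r \<otimes> x'"]
        ideal_sum_principal[OF J, of "x \<oplus> r \<otimes> x'"] i S xc r
      by (auto simp: ideal_interval_def f_def)
  qed
  then have "finite (f ` carrier R)"
    by (intro finite_subset[OF _ fin]) auto
  then obtain C where C: "C \<subseteq> carrier R" "finite C" "f ` carrier R = f ` C"
    using finite_subset_image[of "f ` carrier R" f "carrier R"] by auto
  have key: "r \<ominus> s \<in> ?m" if r: "r \<in> carrier R" and s: "s \<in> carrier R" and "f r = f s" for r s
  proof -
    have "x \<oplus> r \<otimes> x' \<in> f s"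
      using ideal_sum_principal(3)[OF J, of "x \<oplus> r \<otimes> x'"] r xc \<open>f r = f s\<close> by (simp add: f_def)
    then obtain j u where j: "j \<in> J" and u: "u \<in> carrier R"
      and e: "x \<oplus> r \<otimes> x' = j \<oplus> u \<otimes> (x \<oplus> s \<otimes> x')"
      using ideal_sum_principal_iff[OF J, of "x \<oplus> s \<otimes> x'"] s xc by (auto simp: f_def)
    have jc: "j \<in> carrier R" using ideal.Icarr[OF J j] .
    \<comment> \<open>In the resulting identity the left side lies in \<open>T\<close> and the right side in \<open>T'\<close>, hence both in \<open>J\<close>.\<close>
    have "(\<one> \<ominus> u) \<otimes> x = (x \<oplus> r \<otimes> x') \<ominus> r \<otimes> x' \<ominus> u \<otimes> x"
      using xc r u by algebra
    also have "\<dots> = (j \<oplus> u \<otimes> (x \<oplus> s \<otimes> x')) \<ominus> r \<otimes> x' \<ominus> u \<otimes> x"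
      using e by simp
    also have "\<dots> = j \<oplus> (u \<otimes> s \<ominus> r) \<otimes> x'"
      using xc r s u jc by algebra
    finally have E: "(\<one> \<ominus> u) \<otimes> x = j \<oplus> (u \<otimes> s \<ominus> r) \<otimes> x'" .
    have "(\<one> \<ominus> u) \<otimes> x \<in> T"
      using u by (intro ideal.I_l_closed[OF i(2) x(1)]) auto
    moreover have "(\<one> \<ominus> u) \<otimes> x \<in> T'"
      unfolding E using j i'(3) u r s
      by (intro ideal_add_mem[OF i'(2)] ideal.I_l_closed[OF i'(2) x'(1)]) auto
    ultimately have 1: "(\<one> \<ominus> u) \<otimes> x \<in> J" using TT' by auto
    then have a: "\<one> \<ominus> u \<in> ?m"
      using cover_colonI[OF c x] u by simp
    have "(u \<otimes> s \<ominus> r) \<otimes> x' = (j \<oplus> (u \<otimes> s \<ominus> r) \<otimes> x') \<ominus> j"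
      using xc r s u jc by algebra
    then have "(u \<otimes> s \<ominus> r) \<otimes> x' \<in> J"
      using ideal_diff_mem[OF J 1 j] E by simp
    then have b: "u \<otimes> s \<ominus> r \<in> ?m"
      using cover_colonI[OF c' x'] u s r eq by simp
    have "r \<ominus> s = \<zero> \<ominus> ((u \<otimes> s \<ominus> r) \<oplus> s \<otimes> (\<one> \<ominus> u))"
      using r s u by algebra
    then show ?thesis
      using ideal_diff_mem[OF m ideal_zero_mem[OF m]
          ideal_add_mem[OF m b ideal.I_l_closed[OF m a s]]] by simp
  qed
  have "\<exists>c\<in>C. r \<ominus> c \<in> ?m" if r: "r \<in> carrier R" for r
  proof -
    have "f r \<in> f ` C" using C(3) r by auto
    then obtain s where s: "s \<in> C" "f r = f s" by auto
    then have "r \<ominus> s \<in> ?m" using key[OF r] C(1) by auto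
    then show ?thesis using s by auto
  qed
  then show ?thesis
    using C by (auto simp: residue_system_def)
qed

text \<open>
  When \<open>m\<close> annihilates \<open>V/J\<close>, adjoining one element \<open>x\<close> to an ideal between \<open>J\<close> and \<open>V\<close> multiplies
  the number of classes modulo \<open>J\<close> by at most \<open>|C|\<close>, since only multiples \<open>cx\<close> with \<open>c \<in> C\<close> matter,
  and it raises the rank by at least one. So an ideal of largest rank for which the bound holds
  must be \<open>V\<close>.
\<close>
lemma (in cring) finite_representatives:
  assumes \<rho>: "rank_function R {\<zero>} L \<rho>"
    and C: "residue_system R m C"
    and J: "ideal J R" and V: "ideal V R" "J \<subseteq> V" "V \<subseteq> L"
    and mV: "\<And>r v. r \<in> m \<Longrightarrow> v \<in> V \<Longrightarrow> r \<otimes> v \<in> J"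
  shows "\<exists>D\<subseteq>V. finite D \<and> card D \<le> card C ^ \<rho> V \<and> (\<forall>v\<in>V. \<exists>d\<in>D. v \<ominus> d \<in> J)"
proof -
  define P where "P = (\<lambda>W. ideal W R \<and> J \<subseteq> W \<and> W \<subseteq> V \<and>
    (\<exists>D\<subseteq>W. finite D \<and> card D \<le> card C ^ \<rho> W \<and> (\<forall>v\<in>W. \<exists>d\<in>D. v \<ominus> d \<in> J)))"
  have finC: "finite C" "C \<subseteq> carrier R" using C by (auto simp: residue_system_def)
  have "C \<noteq> {}"
    using C zero_closed unfolding residue_system_def by blast
  then have C1: "1 \<le> card C"
    using finC by (simp add: Suc_le_eq card_gt_0_iff)
  have "P J"
    unfolding P_def
  proof (intro conjI exI[of _ "{\<zero>}"])
    show "\<forall>v\<in>J. \<exists>d\<in>{\<zero>}. v \<ominus> d \<in> J"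
      using ideal.Icarr[OF J] by (simp add: a_minus_def)
  qed (use J V C1 ideal_zero_mem[OF J] in auto)
  moreover have "\<rho> W < Suc (\<rho> V)" if "P W" for W
    using rank_function_le[OF \<rho> _ V(1) _ _ V(3), of W] ideal_zero_mem[of W R] that
    by (auto simp: P_def less_Suc_eq_le)
  ultimately obtain W where W: "P W" and great: "\<And>W'. P W' \<Longrightarrow> \<rho> W' \<le> \<rho> W"
    using ex_has_greatest_nat[of P J \<rho> "Suc (\<rho> V)"] by (auto simp: less_imp_le)
  have Wi: "ideal W R" "J \<subseteq> W" "W \<subseteq> V" using W by (auto simp: P_def)
  obtain D where D: "D \<subseteq> W" "finite D" "card D \<le> card C ^ \<rho> W" "\<And>v. v \<in> W \<Longrightarrow> \<exists>d\<in>D. v \<ominus> d \<in> J"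
    using W by (auto simp: P_def)
  have "W = V"
  proof (rule ccontr)
    assume "W \<noteq> V"
    then obtain x where x: "x \<in> V" "x \<notin> W" using Wi by auto
    have xc: "x \<in> carrier R" using ideal.Icarr[OF V(1) x(1)] .
    let ?W = "W <+> PIdl x"
    let ?D = "(\<lambda>(d, c). d \<oplus> c \<otimes> x) ` (D \<times> C)"
    note p = ideal_sum_principal[OF Wi(1) xc]
    have sub: "?W \<subseteq> V" by (rule ideal_sum_principal_least[OF V(1) Wi(3) x(1)])
    have less: "\<rho> W < \<rho> ?W"
      using rank_function_less[OF \<rho> Wi(1) p(1)] ideal_zero_mem[OF Wi(1)] p(2,3) x(2) sub V(3) by auto
    have "P ?W"
      unfolding P_def
    proof (intro conjI exI[of _ ?D] ballI)
      show "ideal ?W R" "J \<subseteq> ?W" "?W \<subseteq> V" "finite ?D"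
        using p Wi sub D finC by auto
      show "?D \<subseteq> ?W"
        using D(1) finC(2) by (auto simp: ideal_sum_principal_iff[OF Wi(1) xc] subset_iff intro: bexI)
      have "card ?D \<le> card (D \<times> C)"
        by (rule card_image_le) (use D finC in auto)
      also have "\<dots> \<le> card C ^ \<rho> W * card C"
        using D(3) by (simp add: card_cartesian_product)
      also have "\<dots> = card C ^ Suc (\<rho> W)"
        by simp
      also have "\<dots> \<le> card C ^ \<rho> ?W"
        using less C1 by (intro power_increasing) auto
      finally show "card ?D \<le> card C ^ \<rho> ?W" .
      fix v assume "v \<in> ?W"
      then obtain w r where w: "w \<in> W" and r: "r \<in> carrier R" and v: "v = w \<oplus> r \<otimes> x"
        by (auto simp: ideal_sum_principal_iff[OF Wi(1) xc])
      obtain d where d: "d \<in> D" "w \<ominus> d \<in> J" using D(4)[OF w] by auto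
      obtain c where c: "c \<in> C" "r \<ominus> c \<in> m" using C r unfolding residue_system_def by blast
      have cl: "w \<in> carrier R" "d \<in> carrier R" "c \<in> carrier R"
        using ideal.Icarr[OF Wi(1)] w d(1) D(1) c(1) finC(2) by auto
      have "v \<ominus> (d \<oplus> c \<otimes> x) = (w \<ominus> d) \<oplus> (r \<ominus> c) \<otimes> x"
        unfolding v using cl r xc by algebra
      then have "v \<ominus> (d \<oplus> c \<otimes> x) \<in> J"
        using ideal_add_mem[OF J d(2) mV[OF c(2) x(1)]] by simp
      then show "\<exists>d\<in>?D. v \<ominus> d \<in> J"
        using d(1) c(1) by force
    qed
    then show False using great[of ?W] less by simp
  qed
  then show ?thesis using D by blast
qed

text \<open>
  The covers with \<open>(J : T) = m\<close> all lie in \<open>V = S \<inter> (J : m)\<close>, and \<open>m\<close> annihilates \<open>V/J\<close>. If \<open>R/m\<close> is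
  finite, each cover is generated modulo \<open>J\<close> by one of the finitely many representatives of \<open>V/J\<close>;
  otherwise there is at most one cover. The bound depends on \<open>m\<close> and \<open>L\<close> alone.
\<close>
lemma (in cring) bounded_covers_with_colon:
  assumes \<rho>: "rank_function R {\<zero>} L \<rho>" and L: "ideal L R" and m: "ideal m R"
  shows "\<exists>b. \<forall>J S. finite_subinterval R L J S \<longrightarrow> card {T. covers R J T \<and> T \<subseteq> S \<and> colon R J T = m} \<le> b"
proof (cases "\<exists>C. residue_system R m C")
  case True
  then obtain C where C: "residue_system R m C" by auto
  then have "C \<noteq> {}"
    using zero_closed unfolding residue_system_def by blast
  then have C1: "1 \<le> card C"
    using C by (simp add: residue_system_def Suc_le_eq card_gt_0_iff)
  have "card {T. covers R J T \<and> T \<subseteq> S \<and> colon R J T = m} \<le> card C ^ \<rho> L"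
    if JS: "finite_subinterval R L J S" for J S
  proof -
    note J = finite_subintervalD(1)[OF JS] and S = finite_subintervalD(2-4)[OF JS]
    define V where "V = S \<inter> colon R J m"
    have V: "ideal V R"
      unfolding V_def by (rule i_intersect[OF S(1) colon_ideal[OF J ideal_sub_carrier[OF m]]])
    have JV: "J \<subseteq> V"
      using S ideal.Icarr[OF J] ideal.I_r_closed[OF J] ideal.Icarr[OF m]
      by (auto simp: V_def colon_def)
    have mV: "r \<otimes> v \<in> J" if "r \<in> m" "v \<in> V" for r v
      using that m_comm ideal.Icarr[OF m] by (auto simp: V_def colon_def)
    have VL: "V \<subseteq> L" using S by (auto simp: V_def)
    obtain D where D: "D \<subseteq> V" "finite D" "card D \<le> card C ^ \<rho> V" "\<And>v. v \<in> V \<Longrightarrow> \<exists>d\<in>D. v \<ominus> d \<in> J"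
      using finite_representatives[OF \<rho> C J V JV VL mV] by auto
    have "T \<in> (\<lambda>d. J <+> PIdl d) ` D" if c: "covers R J T" and T: "T \<subseteq> S" "colon R J T = m" for T
    proof -
      note i = covers_ideals[OF c]
      note TC = ideal.Icarr[OF i(2)]
      have TV: "T \<subseteq> V"
        using T TC m_comm by (auto simp: V_def colon_def)
      obtain v where v: "v \<in> T" "v \<notin> J" using i by auto
      then obtain d where d: "d \<in> D" "v \<ominus> d \<in> J" using D(4) TV by auto
      have cl: "v \<in> carrier R" "d \<in> carrier R"
        using TC v d(1) D(1) ideal.Icarr[OF V] by auto
      have "d = v \<ominus> (v \<ominus> d)" using cl by algebra
      then have "d \<in> T"
        using ideal_diff_mem[OF i(2) v(1), of "v \<ominus> d"] d(2) i(3) by auto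
      moreover have "d \<notin> J"
      proof
        assume "d \<in> J"
        then have "(v \<ominus> d) \<oplus> d \<in> J" by (rule ideal_add_mem[OF J d(2)])
        moreover have "(v \<ominus> d) \<oplus> d = v" using cl by algebra
        ultimately show False using v(2) by simp
      qed
      ultimately show ?thesis
        using cover_eq_principal[OF c] d(1) by auto
    qed
    then have "card {T. covers R J T \<and> T \<subseteq> S \<and> colon R J T = m} \<le> card ((\<lambda>d. J <+> PIdl d) ` D)"
      using D(2) by (intro card_mono) auto
    also have "\<dots> \<le> card D" by (rule card_image_le[OF D(2)])
    also have "\<dots> \<le> card C ^ \<rho> V" by (rule D(3))
    also have "\<dots> \<le> card C ^ \<rho> L"
      using rank_function_le[OF \<rho> V L _ VL order.refl] ideal_zero_mem[OF V] C1
      by (intro power_increasing) auto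
    finally show ?thesis .
  qed
  then show ?thesis by blast
next
  case False
  have "card {T. covers R J T \<and> T \<subseteq> S \<and> colon R J T = m} \<le> Suc 0"
    if JS: "finite_subinterval R L J S" for J S
  proof -
    note S = finite_subintervalD(2)[OF JS] and fin = finite_subintervalD(5)[OF JS]
    let ?U = "{T. covers R J T \<and> T \<subseteq> S \<and> colon R J T = m}"
    have finU: "finite ?U"
      by (rule finite_subset[OF _ fin]) (auto simp: ideal_interval_def covers_def)
    have "T = T'" if T: "T \<in> ?U" and T': "T' \<in> ?U" for T T'
    proof (rule ccontr)
      have c: "covers R J T" "covers R J T'" "T \<subseteq> S" "T' \<subseteq> S"
        and m: "colon R J T = m" "colon R J T' = m"
        using T T' by auto
      assume "T \<noteq> T'"
      then show False
        using two_covers_imp_finite_residue[OF c(1,2) _ _ S c(3,4) fin] m False by simp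
    qed
    then show ?thesis
      unfolding card_le_Suc0_iff_eq[OF finU] by blast
  qed
  then show ?thesis by blast
qed

text \<open>
  The colon ideals \<open>(J : T)\<close> are maximal and contain \<open>(0 : L)\<close>, so they range over a finite set, and
  the bounds for the single colon ideals can be summed.
\<close>
lemma (in cring) bounded_covers:
  assumes \<rho>: "rank_function R {\<zero>} L \<rho>" and L: "ideal L R"
  shows "\<exists>t. \<forall>J S. finite_subinterval R L J S \<longrightarrow> card {T. covers R J T \<and> T \<subseteq> S} \<le> t"
proof -
  define M where "M = {p. maximalideal p R \<and> colon R {\<zero>} L \<subseteq> p}"
  have finM: "finite M"
    unfolding M_def
    by (rule finite_maximal_over_colon[OF \<rho> zeroideal L]) (use ideal_zero_mem[OF L] in auto)
  define K where "K = (\<lambda>m J S. {T. covers R J T \<and> T \<subseteq> S \<and> colon R J T = m})"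
  have "\<exists>b. \<forall>m\<in>M. \<forall>J S. finite_subinterval R L J S \<longrightarrow> card (K m J S) \<le> b m"
    unfolding K_def
    using bounded_covers_with_colon[OF \<rho> L maximalideal.axioms(1)]
    by (intro bchoice) (auto simp: M_def)
  then obtain b where b: "\<And>m J S. m \<in> M \<Longrightarrow> finite_subinterval R L J S \<Longrightarrow> card (K m J S) \<le> b m"
    by auto
  have "card {T. covers R J T \<and> T \<subseteq> S} \<le> (\<Sum>m\<in>M. b m)"
    if JS: "finite_subinterval R L J S" for J S
  proof -
    note J = finite_subintervalD(1)[OF JS] and S = finite_subintervalD(2-4)[OF JS]
      and fin = finite_subintervalD(5)[OF JS]
    have "colon R J T \<in> M" if c: "covers R J T" and T: "T \<subseteq> S" for T
    proof -
      have "colon R {\<zero>} L \<subseteq> colon R J T"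
        using T S(3) ideal_zero_mem[OF J] by (auto simp: colon_def)
      then show ?thesis
        using cover_colon_maximal[OF c] by (simp add: M_def)
    qed
    then have sub: "{T. covers R J T \<and> T \<subseteq> S} \<subseteq> (\<Union>m\<in>M. K m J S)"
      by (auto simp: K_def)
    have finK: "finite (K m J S)" for m
      by (rule finite_subset[OF _ fin]) (auto simp: K_def ideal_interval_def covers_def)
    have "card {T. covers R J T \<and> T \<subseteq> S} \<le> card (\<Union>m\<in>M. K m J S)"
      using finM finK by (intro card_mono[OF _ sub]) auto
    also have "\<dots> \<le> (\<Sum>m\<in>M. card (K m J S))"
      by (rule card_UN_le[OF finM])
    also have "\<dots> \<le> (\<Sum>m\<in>M. b m)"
      using b[OF _ JS] by (intro sum_mono)
    finally show ?thesis .
  qed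
  then show ?thesis by auto
qed

text \<open>
  Every ideal other than \<open>J\<close> in the interval contains a cover of \<open>J\<close>. There are at most \<open>t\<close> covers,
  and each starts an interval of smaller rank difference. This gives the recursion
  \<open>b\<^sub>n\<^sub>+\<^sub>1 = 1 + t b\<^sub>n\<close> in the rank difference \<open>n\<close>, which is at most the rank of \<open>L\<close>.
\<close>
lemma (in cring) bounded_finite_intervals:
  assumes \<rho>: "rank_function R {\<zero>} L \<rho>" and L: "ideal L R"
  shows "\<exists>b. \<forall>J S. finite_subinterval R L J S \<longrightarrow> card (ideal_interval R J S) \<le> b"
proof -
  obtain t where t: "\<And>J S. finite_subinterval R L J S \<Longrightarrow> card {T. covers R J T \<and> T \<subseteq> S} \<le> t"
    using bounded_covers[OF assms] by auto
  have "\<exists>b. \<forall>J S. finite_subinterval R L J S \<longrightarrow> \<rho> S \<le> \<rho> J + n \<longrightarrow> card (ideal_interval R J S) \<le> b" for n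
  proof (induction n)
    case 0
    have "card (ideal_interval R J S) \<le> 1"
      if JS: "finite_subinterval R L J S" and le: "\<rho> S \<le> \<rho> J + 0" for J S
    proof -
      note that = finite_subintervalD[OF JS] le
      have "J = S"
        using rank_function_less[OF \<rho> that(1,2)] ideal_zero_mem[OF that(1)] that by fastforce
      then have "ideal_interval R J S = {S}"
        using that by (auto simp: ideal_interval_def)
      then show ?thesis by simp
    qed
    then show ?case by auto
  next
    case (Suc n)
    then obtain b where b: "\<And>J S. finite_subinterval R L J S \<Longrightarrow> \<rho> S \<le> \<rho> J + n \<Longrightarrow> card (ideal_interval R J S) \<le> b"
      by auto
    have "card (ideal_interval R J S) \<le> 1 + t * b"
      if JS: "finite_subinterval R L J S" and le: "\<rho> S \<le> \<rho> J + Suc n" for J S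
    proof -
      note J = finite_subintervalD(1)[OF JS] and S = finite_subintervalD(2-4)[OF JS]
        and fin = finite_subintervalD(5)[OF JS]
      let ?U = "{T. covers R J T \<and> T \<subseteq> S}"
      have finU: "finite ?U"
        by (rule finite_subset[OF _ fin]) (auto simp: ideal_interval_def covers_def)
      have finT: "finite (ideal_interval R T S)" if "T \<in> ?U" for T
        by (rule finite_subset[OF _ fin]) (use that in \<open>auto simp: ideal_interval_def covers_def\<close>)
      have bT: "card (ideal_interval R T S) \<le> b" if T: "T \<in> ?U" for T
      proof -
        have c: "covers R J T" and TS: "T \<subseteq> S" using T by auto
        note i = covers_ideals[OF c]
        have "\<rho> J < \<rho> T"
          using rank_function_less[OF \<rho> J i(2)] ideal_zero_mem[OF J] i TS S(3) by auto
        then show ?thesis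
          using b[of T S] i(2) S(1,3) TS finT[OF T] le by (simp add: finite_subinterval_def)
      qed
      obtain \<sigma> where \<sigma>: "rank_function R J S \<sigma>"
        using finite_interval_imp_finite_length[OF fin] by (auto simp: finite_length_def)
      have "X \<in> (\<Union>T\<in>?U. ideal_interval R T S)"
        if X: "X \<in> ideal_interval R J S" and "X \<noteq> J" for X
      proof -
        obtain T where "covers R J T" "T \<subseteq> X"
          using exists_cover[OF rank_function_subinterval[OF \<sigma> order.refl, of X] J] X \<open>X \<noteq> J\<close>
          by (auto simp: ideal_interval_def)
        then show "X \<in> (\<Union>T\<in>?U. ideal_interval R T S)"
          using X by (auto simp: ideal_interval_def)
      qed
      then have "card (ideal_interval R J S) \<le> card (insert J (\<Union>T\<in>?U. ideal_interval R T S))"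
        using finU finT by (intro card_mono) auto
      also have "\<dots> \<le> Suc (card (\<Union>T\<in>?U. ideal_interval R T S))"
        by (rule card_insert_le_m1) auto
      also have "card (\<Union>T\<in>?U. ideal_interval R T S) \<le> (\<Sum>T\<in>?U. card (ideal_interval R T S))"
        by (rule card_UN_le[OF finU])
      also have "\<dots> \<le> card ?U * b"
        using sum_bounded_above[of ?U "\<lambda>T. card (ideal_interval R T S)" b] bT by simp
      also have "\<dots> \<le> t * b"
        using t[OF JS] by simp
      finally show ?thesis by simp
    qed
    then show ?case by blast
  qed
  then obtain b where b: "\<And>J S. finite_subinterval R L J S \<Longrightarrow> \<rho> S \<le> \<rho> J + \<rho> L \<Longrightarrow> card (ideal_interval R J S) \<le> b"
    by metis
  have "card (ideal_interval R J S) \<le> b"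
    if JS: "finite_subinterval R L J S" for J S
  proof -
    note S = finite_subintervalD(2,4)[OF JS]
    show ?thesis
      using b[OF JS] rank_function_le[OF \<rho> S(1) L _ S(2) order.refl] ideal_zero_mem[OF S(1)]
      by (simp add: trans_le_add2)
  qed
  then show ?thesis by auto
qed

section \<open>Orthogonal families of non-nilpotent elements\<close>

definition orthogonal_non_nilpotents :: "('a, 'b) ring_scheme \<Rightarrow> 'a set \<Rightarrow> 'a set \<Rightarrow> bool" where
  "orthogonal_non_nilpotents R J F \<longleftrightarrow> finite F \<and> F \<subseteq> carrier R \<and>
     (\<forall>x\<in>F. \<forall>y\<in>F. x \<noteq> y \<longrightarrow> x \<otimes>\<^bsub>R\<^esub> y \<in> J) \<and> (\<forall>x\<in>F. \<forall>k::nat. x [^]\<^bsub>R\<^esub> k \<notin> J)"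

text \<open>
  Noetherian induction on \<open>J\<close>. For \<open>J\<close> prime or the whole ring a family has at most one element. Otherwise choose
  \<open>a, b \<notin> J\<close> with \<open>ab \<in> J\<close>. Since \<open>(J + Ra)(J + Rb) \<subseteq> J\<close>, an element that is nilpotent modulo both
  factors is nilpotent modulo \<open>J\<close>; so the family splits into one family modulo \<open>J + Ra\<close> and one modulo
  \<open>J + Rb\<close>.
\<close>
lemma (in cring) bounded_orthogonal_non_nilpotents:
  assumes "noetherian_ring R" and "ideal J R"
  shows "\<exists>n. \<forall>F. orthogonal_non_nilpotents R J F \<longrightarrow> card F \<le> n"
proof -
  interpret noetherian_ring R by fact
  let ?orth = "orthogonal_non_nilpotents R"
  define bdd where "bdd = (\<lambda>J. \<exists>n. \<forall>F. ?orth J F \<longrightarrow> card F \<le> n)"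
  have "bdd J"
  proof (rule ccontr)
    assume "\<not> bdd J"
    then have "\<exists>M\<in>{I. ideal I R \<and> \<not> bdd I}. \<forall>X\<in>{I. ideal I R \<and> \<not> bdd I}. M \<subseteq> X \<longrightarrow> X = M"
      using assms(2) by (intro exists_maximal_in) auto
    then obtain M where M: "ideal M R" "\<not> bdd M"
      and max: "\<And>X. ideal X R \<Longrightarrow> M \<subseteq> X \<Longrightarrow> X \<noteq> M \<Longrightarrow> bdd X"
      by auto
    have "\<exists>a\<in>carrier R. \<exists>b\<in>carrier R. a \<otimes> b \<in> M \<and> a \<notin> M \<and> b \<notin> M"
    proof (rule ccontr)
      assume no: "\<not> ?thesis"
      have "card F \<le> Suc 0" if F: "?orth M F" for F
      proof -
        have fin: "finite F" using F by (simp add: orthogonal_non_nilpotents_def)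
        have "x = y" if xy: "x \<in> F" "y \<in> F" for x y
        proof (rule ccontr)
          assume "x \<noteq> y"
          then have "x \<otimes> y \<in> M" and c: "x \<in> carrier R" "y \<in> carrier R"
            using F xy by (auto simp: orthogonal_non_nilpotents_def)
          then have "x [^] (1::nat) \<in> M \<or> y [^] (1::nat) \<in> M"
            using no by auto
          then show False
            using F xy unfolding orthogonal_non_nilpotents_def by blast
        qed
        then show ?thesis
          unfolding card_le_Suc0_iff_eq[OF fin] by blast
      qed
      then have "bdd M" unfolding bdd_def by blast
      with M(2) show False by contradiction
    qed
    then obtain a b where ab: "a \<in> carrier R" "b \<in> carrier R" "a \<otimes> b \<in> M" "a \<notin> M" "b \<notin> M"
      by auto
    let ?A = "M <+> PIdl a" and ?B = "M <+> PIdl b"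
    note A = ideal_sum_principal[OF M(1) ab(1)] and B = ideal_sum_principal[OF M(1) ab(2)]
    have "bdd ?A" "bdd ?B"
      using max[OF A(1,2)] max[OF B(1,2)] A(3) B(3) ab(4,5) by auto
    then obtain n n' where n: "\<And>F. ?orth ?A F \<Longrightarrow> card F \<le> n" and n': "\<And>F. ?orth ?B F \<Longrightarrow> card F \<le> n'"
      unfolding bdd_def by auto
    have AB: "u \<otimes> v \<in> M" if u: "u \<in> ?A" and v: "v \<in> ?B" for u v
    proof -
      obtain i r where i: "i \<in> M" "r \<in> carrier R" "u = i \<oplus> r \<otimes> a"
        using u ideal_sum_principal_iff[OF M(1) ab(1)] by auto
      obtain j s where j: "j \<in> M" "s \<in> carrier R" "v = j \<oplus> s \<otimes> b"
        using v ideal_sum_principal_iff[OF M(1) ab(2)] by auto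
      have c: "i \<in> carrier R" "j \<in> carrier R"
        using i(1) j(1) ideal.Icarr[OF M(1)] by auto
      have "u \<otimes> v = (j \<oplus> s \<otimes> b) \<otimes> i \<oplus> ((r \<otimes> a) \<otimes> j \<oplus> (r \<otimes> s) \<otimes> (a \<otimes> b))"
        unfolding i(3) j(3) using c i(2) j(2) ab(1,2) by algebra
      then show ?thesis
        using c i(1,2) j(1,2) ab(1,2,3)
        by (simp add: ideal_add_mem[OF M(1)] ideal.I_l_closed[OF M(1)])
    qed
    have "card F \<le> n + n'" if F: "?orth M F" for F
    proof -
      define FA where "FA = {x\<in>F. \<forall>k::nat. x [^] k \<notin> ?A}"
      define FB where "FB = {x\<in>F. \<forall>k::nat. x [^] k \<notin> ?B}"
      have "x \<in> FA \<union> FB" if x: "x \<in> F" for x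
      proof (rule ccontr)
        assume "x \<notin> FA \<union> FB"
        then obtain k l :: nat where kl: "x [^] k \<in> ?A" "x [^] l \<in> ?B"
          using x by (auto simp: FA_def FB_def)
        have "x \<in> carrier R" using F x by (auto simp: orthogonal_non_nilpotents_def)
        then have "x [^] (k + l) \<in> M"
          using AB[OF kl] by (simp add: nat_pow_mult)
        then show False using F x unfolding orthogonal_non_nilpotents_def by blast
      qed
      then have "F \<subseteq> FA \<union> FB" by auto
      moreover have "finite (FA \<union> FB)"
        using F by (simp add: FA_def FB_def orthogonal_non_nilpotents_def)
      ultimately have "card F \<le> card FA + card FB"
        using card_mono[of "FA \<union> FB" F] card_Un_le[of FA FB] by linarith
      moreover have "?orth ?A FA"
        using F A(2) unfolding orthogonal_non_nilpotents_def FA_def by auto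
      moreover have "?orth ?B FB"
        using F B(2) unfolding orthogonal_non_nilpotents_def FB_def by auto
      ultimately show ?thesis
        using n[of FA] n'[of FB] by linarith
    qed
    then have "bdd M" unfolding bdd_def by blast
    with M(2) show False by contradiction
  qed
  then show ?thesis
    unfolding bdd_def .
qed

section \<open>Cliques of the annihilating-ideal graph\<close>

lemma (in cring) submodule_ideal_module_iff:
  assumes I: "ideal I R"
  shows "submodule N R (ideal_module R I) \<longleftrightarrow> N \<in> ideal_interval R {\<zero>} I"
proof
  interpret M: module R "ideal_module R I" by (rule ideal_module_is_module[OF I])
  have inv: "\<ominus>\<^bsub>ideal_module R I\<^esub> x = \<ominus> x" if "x \<in> I" for x
  proof -
    have "\<ominus> x \<in> I"
      using additive_subgroup.a_inv_closed[OF ideal.axioms(1)[OF I] that] .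
    then show ?thesis
      using that ideal.Icarr[OF I]
      by (intro M.minus_equality) (auto simp: ideal_module_def l_neg)
  qed
  {
    assume N: "submodule N R (ideal_module R I)"
    note E = M.submoduleE[OF N]
    have NI: "N \<subseteq> I" using E(1) by (simp add: ideal_module_def)
    note NC = ideal.Icarr[OF I subsetD[OF NI]]
    have "ideal N R"
    proof (rule idealI[OF ring_axioms])
      show "subgroup N (add_monoid R)"
      proof (rule add.subgroupI)
        show "N \<subseteq> carrier R" "N \<noteq> {}" using NC E(2) by auto
        show "\<ominus> a \<in> N" if "a \<in> N" for a
          using E(3)[OF that] inv[of a] NI that by auto
        show "a \<oplus> b \<in> N" if "a \<in> N" "b \<in> N" for a b
          using E(5)[OF that] by (simp add: ideal_module_def)
      qed
      show l: "x \<otimes> a \<in> N" if "a \<in> N" "x \<in> carrier R" for a x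
        using E(4)[OF that(2,1)] by (simp add: ideal_module_def)
      show "a \<otimes> x \<in> N" if "a \<in> N" "x \<in> carrier R" for a x
        using l[OF that] that NC by (simp add: m_comm)
    qed
    then show "N \<in> ideal_interval R {\<zero>} I"
      using NI ideal_zero_mem by (auto simp: ideal_interval_def)
  next
    assume "N \<in> ideal_interval R {\<zero>} I"
    then have N: "ideal N R" "N \<subseteq> I" by (auto simp: ideal_interval_def)
    show "submodule N R (ideal_module R I)"
    proof (rule M.submoduleI)
      show "\<ominus>\<^bsub>ideal_module R I\<^esub> a \<in> N" if "a \<in> N" for a
        using inv[of a] that N additive_subgroup.a_inv_closed[OF ideal.axioms(1)[OF N(1)] that] by auto
    qed (use N ideal_zero_mem[OF N(1)] ideal_add_mem[OF N(1)] ideal.I_l_closed[OF N(1)]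
        in \<open>auto simp: ideal_module_def\<close>)
  }
qed

lemma AG_edges_prod_zero:
  assumes "cring R" and "{I, J} \<in> AG_edges R"
  shows "I \<cdot>\<^bsub>R\<^esub> J = {\<zero>\<^bsub>R\<^esub>}"
proof -
  interpret cring R by fact
  obtain I' J' where e: "{I, J} = {I', J'}" and I': "I' \<in> AG_verts R" "J' \<in> AG_verts R"
    and p: "I' \<cdot>\<^bsub>R\<^esub> J' = {\<zero>\<^bsub>R\<^esub>}"
    using assms(2) by (auto simp: AG_edges_def)
  have "ideal I' R" "ideal J' R"
    using I' by (auto simp: AG_verts_def annihilating_ideal_def)
  then have "J' \<cdot>\<^bsub>R\<^esub> I' = {\<zero>\<^bsub>R\<^esub>}"
    using p ideal_prod_commute by simp
  then show ?thesis
    using e p by (auto simp: doubleton_eq_iff)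
qed

lemma clique_number_finite_iff:
  "clique_number V E < \<infinity> \<longleftrightarrow> (\<exists>n. \<forall>K. K \<subseteq> V \<longrightarrow> finite K \<longrightarrow> clique K E \<longrightarrow> card K \<le> n)"
proof
  assume "clique_number V E < \<infinity>"
  then obtain n where n: "clique_number V E = enat n" by auto
  have "card K \<le> n" if "K \<subseteq> V" "finite K" "clique K E" for K
  proof -
    have "enat (card K) \<le> clique_number V E"
      unfolding clique_number_def by (rule SUP_upper) (use that in auto)
    then show ?thesis using n by simp
  qed
  then show "\<exists>n. \<forall>K. K \<subseteq> V \<longrightarrow> finite K \<longrightarrow> clique K E \<longrightarrow> card K \<le> n" by auto
next
  assume "\<exists>n. \<forall>K. K \<subseteq> V \<longrightarrow> finite K \<longrightarrow> clique K E \<longrightarrow> card K \<le> n"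
  then obtain n where n: "\<And>K. K \<subseteq> V \<Longrightarrow> finite K \<Longrightarrow> clique K E \<Longrightarrow> card K \<le> n" by auto
  then have "clique_number V E \<le> enat n"
    unfolding clique_number_def by (intro SUP_least) auto
  then show "clique_number V E < \<infinity>"
    using le_less_trans[of _ "enat n" \<infinity>] by simp
qed

lemma (in cring) square_zero_subideals_clique:
  assumes I: "ideal I R" "I \<cdot> I = {\<zero>}" and K: "K \<subseteq> ideal_interval R {\<zero>} I - {{\<zero>}}"
  shows "K \<subseteq> AG_verts R" "clique K (AG_edges R)"
proof -
  have KI: "ideal X R" "X \<subseteq> I" "X \<noteq> {\<zero>}" if "X \<in> K" for X
    using K that by (auto simp: ideal_interval_def)
  have prod0: "X \<cdot> Y = {\<zero>}" if X: "X \<in> K" and Y: "Y \<in> K" for X Y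
  proof -
    have "\<forall>x\<in>I. \<forall>y\<in>I. x \<otimes> y = \<zero>"
      using I(2) unfolding ideal_prod_eq_zero_iff[OF I(1) I(1)] .
    then show ?thesis
      unfolding ideal_prod_eq_zero_iff[OF KI(1)[OF X] KI(1)[OF Y]]
      using KI(2)[OF X] KI(2)[OF Y] by auto
  qed
  show verts: "K \<subseteq> AG_verts R"
  proof
    fix X assume X: "X \<in> K"
    then have "annihilating_ideal R X"
      unfolding annihilating_ideal_iff
      by (intro conjI exI[of _ X] KI prod0)
    then show "X \<in> AG_verts R"
      using KI(3)[OF X] by (simp add: AG_verts_def)
  qed
  show "clique K (AG_edges R)"
    unfolding clique_def AG_edges_def
  proof (intro ballI impI CollectI)
    fix X Y assume XY: "X \<in> K" "Y \<in> K" "X \<noteq> Y"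
    show "\<exists>I J. {X, Y} = {I, J} \<and> I \<in> AG_verts R \<and> J \<in> AG_verts R \<and> I \<noteq> J \<and> I \<cdot> J = {\<zero>}"
      using verts XY prod0[OF XY(1,2)] by (intro exI[of _ X] exI[of _ Y]) auto
  qed
qed

lemma (in cring) largest_finite_length_ideal:
  assumes "noetherian_ring R"
  obtains L where "ideal L R" "finite_length R {\<zero>} L"
    "\<And>I. ideal I R \<Longrightarrow> finite_length R {\<zero>} I \<Longrightarrow> I \<subseteq> L"
proof -
  interpret noetherian_ring R by fact
  have "finite (ideal_interval R {\<zero>} {\<zero>})"
    by (rule finite_subset[of _ "{{\<zero>}}"]) (auto simp: ideal_interval_def)
  then have "finite_length R {\<zero>} {\<zero>}"
    by (rule finite_interval_imp_finite_length)
  then have "{I. ideal I R \<and> finite_length R {\<zero>} I} \<noteq> {}"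
    using zeroideal by auto
  then have "\<exists>L\<in>{I. ideal I R \<and> finite_length R {\<zero>} I}.
      \<forall>X\<in>{I. ideal I R \<and> finite_length R {\<zero>} I}. L \<subseteq> X \<longrightarrow> X = L"
    by (intro exists_maximal_in) auto
  then obtain L where L: "ideal L R" "finite_length R {\<zero>} L"
    and max: "\<And>X. ideal X R \<Longrightarrow> finite_length R {\<zero>} X \<Longrightarrow> L \<subseteq> X \<Longrightarrow> X = L"
    by auto
  have "I \<subseteq> L" if I: "ideal I R" "finite_length R {\<zero>} I" for I
    using max[OF add_ideals[OF L(1) I(1)] finite_length_sum[OF L(1) I(1) L(2) I(2)]]
      ideal_sum_upper[OF L(1) I(1)] by simp
  with L that show ?thesis by simp
qed

text \<open>
  A new member \<open>I\<close> annihilates the sum of the earlier ones. If it were contained in that sum, then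
  \<open>I\<^sup>2\<close> would vanish; so each member makes the sum strictly larger and raises its rank.
\<close>
lemma (in cring) square_nonzero_clique_bound:
  assumes \<rho>: "rank_function R {\<zero>} L \<rho>" and L: "ideal L R" and "finite K"
    and K: "\<And>I. I \<in> K \<Longrightarrow> ideal I R \<and> I \<subseteq> L \<and> I \<cdot> I \<noteq> {\<zero>}"
    and orth: "\<And>I J. I \<in> K \<Longrightarrow> J \<in> K \<Longrightarrow> I \<noteq> J \<Longrightarrow> I \<cdot> J = {\<zero>}"
  shows "card K \<le> \<rho> L"
proof -
  note LC = ideal_sub_carrier[OF L]
  have "card F \<le> \<rho> (Idl (\<Union>F))" if "F \<subseteq> K" "finite F" for F
    using that(2,1)
  proof (induction F rule: finite_induct)
    case (insert I F)
    let ?X = "Idl (\<Union>F)" and ?Y = "Idl (\<Union>(insert I F))"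
    have I: "ideal I R" "I \<subseteq> L" "I \<cdot> I \<noteq> {\<zero>}" using K insert.prems by auto
    have UL: "\<Union>F \<subseteq> L" "\<Union>(insert I F) \<subseteq> L" using K insert.prems by blast+
    then have UC: "\<Union>F \<subseteq> carrier R" "\<Union>(insert I F) \<subseteq> carrier R" using LC by auto
    note iX = genideal_ideal[OF UC(1)] and iY = genideal_ideal[OF UC(2)]
    have XY: "?X \<subseteq> ?Y" by (rule subset_Idl_subset[OF UC(2)]) auto
    have IY: "I \<subseteq> ?Y" using genideal_self[OF UC(2)] by auto
    have "\<not> I \<subseteq> ?X"
    proof
      assume sub: "I \<subseteq> ?X"
      have IC: "I \<subseteq> carrier R" by (rule ideal_sub_carrier[OF I(1)])
      have "i \<otimes> t = \<zero>" if i: "i \<in> I" and t: "t \<in> \<Union>F" for i t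
      proof -
        obtain J where J: "J \<in> F" "t \<in> J" using t by auto
        then have "I \<noteq> J" "J \<in> K" "I \<in> K" using insert.hyps insert.prems by auto
        then show ?thesis
          using orth[of I J] K[of J] ideal_prod_eq_zero_iff[OF I(1), of J] i J(2) by auto
      qed
      then have "i \<otimes> t = \<zero>" if "i \<in> I" "t \<in> ?X" for i t
        using genideal_mult_zero[OF IC UC(1)] that genideal_self[OF IC] by blast
      then have "I \<cdot> I = {\<zero>}"
        using sub by (auto simp: ideal_prod_eq_zero_iff[OF I(1) I(1)])
      with I(3) show False by contradiction
    qed
    then have "?X \<subset> ?Y" using XY IY by auto
    then have "\<rho> ?X < \<rho> ?Y"
      using rank_function_less[OF \<rho> iX iY] ideal_zero_mem[OF iX] genideal_minimal[OF L UL(2)] by auto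
    then show ?case
      using insert.IH insert.hyps insert.prems by auto
  qed simp
  from this[OF order.refl \<open>finite K\<close>] have "card K \<le> \<rho> (Idl (\<Union>K))" .
  also have "\<dots> \<le> \<rho> L"
  proof -
    have UL: "\<Union>K \<subseteq> L" using K by blast
    then have i: "ideal (Idl (\<Union>K)) R" using LC by (intro genideal_ideal) auto
    show ?thesis
      using rank_function_le[OF \<rho> i L _ genideal_minimal[OF L UL] order.refl] ideal_zero_mem[OF i]
      by simp
  qed
  finally show ?thesis .
qed

text \<open>
  The ideal \<open>S\<close> generated by all members has square zero and lies inside \<open>L\<close>, so the bound
  \<open>b\<close> applies to the ideals below it, which include all members.
\<close>
lemma (in cring) square_zero_clique_bound:
  assumes L: "ideal L R"
    and b: "\<And>S. finite_subinterval R L {\<zero>} S \<Longrightarrow> card (ideal_interval R {\<zero>} S) \<le> b"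
    and sq: "\<And>I. ideal I R \<Longrightarrow> I \<cdot> I = {\<zero>} \<Longrightarrow> finite (ideal_interval R {\<zero>} I)"
    and K: "\<And>I. I \<in> K \<Longrightarrow> ideal I R \<and> I \<subseteq> L"
    and orth: "\<And>I J. I \<in> K \<Longrightarrow> J \<in> K \<Longrightarrow> I \<cdot> J = {\<zero>}"
  shows "card K \<le> b"
proof -
  define S where "S = Idl (\<Union>K)"
  have UL: "\<Union>K \<subseteq> L" using K by blast
  then have UC: "\<Union>K \<subseteq> carrier R" using ideal_sub_carrier[OF L] by auto
  have S: "ideal S R" unfolding S_def by (rule genideal_ideal[OF UC])
  have SL: "S \<subseteq> L" unfolding S_def by (rule genideal_minimal[OF L UL])
  have "s \<otimes> t = \<zero>" if s: "s \<in> \<Union>K" and t: "t \<in> \<Union>K" for s t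
  proof -
    obtain I where I: "I \<in> K" "s \<in> I" using s by auto
    obtain J where J: "J \<in> K" "t \<in> J" using t by auto
    then show ?thesis
      using orth[OF I(1) J(1)] ideal_prod_eq_zero_iff[of I J] K I J by auto
  qed
  then have "S \<cdot> S = {\<zero>}"
    unfolding ideal_prod_eq_zero_iff[OF S S]
    using genideal_mult_zero[OF UC UC] by (simp add: S_def)
  then have fin: "finite (ideal_interval R {\<zero>} S)"
    by (rule sq[OF S])
  have "K \<subseteq> ideal_interval R {\<zero>} S"
    using K ideal_zero_mem genideal_self[OF UC] by (fastforce simp: ideal_interval_def S_def)
  then have "card K \<le> card (ideal_interval R {\<zero>} S)"
    by (rule card_mono[OF fin])
  also have "\<dots> \<le> b"
    using S SL fin zeroideal ideal_zero_mem[OF S] by (intro b) (simp add: finite_subinterval_def)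
  finally show ?thesis .
qed

theorem theorem2p14:
  fixes R :: "('a, 'b) ring_scheme" (structure)
  assumes "cring R" and "noetherian_ring R"
  shows "clique_number (AG_verts R) (AG_edges R) < \<infinity> \<longleftrightarrow>
         (\<forall>I. ideal I R \<and> I \<cdot> I = {\<zero>} \<longrightarrow> finite {N. submodule N R (ideal_module R I)})"
proof -
  interpret cring R by fact
  let ?sq = "\<forall>I. ideal I R \<and> I \<cdot> I = {\<zero>} \<longrightarrow> finite (ideal_interval R {\<zero>} I)"
  have submod: "{N. submodule N R (ideal_module R I)} = ideal_interval R {\<zero>} I" if "ideal I R" for I
    using submodule_ideal_module_iff[OF that] by auto
  have "(\<exists>n. \<forall>K. K \<subseteq> AG_verts R \<longrightarrow> finite K \<longrightarrow> clique K (AG_edges R) \<longrightarrow> card K \<le> n) \<longleftrightarrow> ?sq"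
  proof
    assume "\<exists>n. \<forall>K. K \<subseteq> AG_verts R \<longrightarrow> finite K \<longrightarrow> clique K (AG_edges R) \<longrightarrow> card K \<le> n"
    then obtain n where n: "\<And>K. K \<subseteq> AG_verts R \<Longrightarrow> finite K \<Longrightarrow> clique K (AG_edges R) \<Longrightarrow> card K \<le> n"
      by auto
    have "finite (ideal_interval R {\<zero>} I)" if I: "ideal I R" "I \<cdot> I = {\<zero>}" for I
    proof (rule ccontr)
      assume "infinite (ideal_interval R {\<zero>} I)"
      then have "infinite (ideal_interval R {\<zero>} I - {{\<zero>}})" by simp
      then obtain K where K: "finite K" "card K = Suc n" "K \<subseteq> ideal_interval R {\<zero>} I - {{\<zero>}}"
        using infinite_arbitrarily_large by blast
      show False
        using n[OF square_zero_subideals_clique(1)[OF I K(3)] K(1)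
            square_zero_subideals_clique(2)[OF I K(3)]] K(2) by simp
    qed
    then show ?sq by auto
  next
    assume ?sq
    then have sq: "\<And>I. ideal I R \<Longrightarrow> I \<cdot> I = {\<zero>} \<Longrightarrow> finite (ideal_interval R {\<zero>} I)"
      by auto
    obtain L where L: "ideal L R" "finite_length R {\<zero>} L"
      and Lmax: "\<And>I. ideal I R \<Longrightarrow> finite_length R {\<zero>} I \<Longrightarrow> I \<subseteq> L"
      using largest_finite_length_ideal[OF assms(2)] by auto
    obtain \<rho> where \<rho>: "rank_function R {\<zero>} L \<rho>"
      using L(2) by (auto simp: finite_length_def)
    have nil: "x \<in> L" if x: "x \<in> carrier R" "x [^] k = \<zero>" for x and k :: nat
    proof -
      have "finite_length R {\<zero>} (PIdl x)"
        using nilpotent_finite_length[OF finite_interval_imp_finite_length[OF sq] x] .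
      then show ?thesis
        using Lmax[OF cgenideal_ideal[OF x(1)]] cgenideal_self[OF x(1)] by auto
    qed
    obtain b where b: "\<And>J S. finite_subinterval R L J S \<Longrightarrow> card (ideal_interval R J S) \<le> b"
      using bounded_finite_intervals[OF \<rho> L(1)] by blast
    obtain n where n: "\<And>F. orthogonal_non_nilpotents R {\<zero>} F \<Longrightarrow> card F \<le> n"
      using bounded_orthogonal_non_nilpotents[OF assms(2) zeroideal] by blast
    have "card K \<le> n + (\<rho> L + b)"
      if K: "K \<subseteq> AG_verts R" "finite K" "clique K (AG_edges R)" for K
    proof -
      have Ki: "ideal I R" if "I \<in> K" for I
        using K(1) that by (auto simp: AG_verts_def annihilating_ideal_def)
      have orth: "I \<cdot> J = {\<zero>}" if "I \<in> K" "J \<in> K" "I \<noteq> J" for I J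
        using K(3) that AG_edges_prod_zero[OF assms(1)] by (auto simp: clique_def)
      define K1 where "K1 = {I\<in>K. \<not> I \<subseteq> L}"
      define K2 where "K2 = {I\<in>K. I \<subseteq> L \<and> I \<cdot> I \<noteq> {\<zero>}}"
      define K3 where "K3 = {I\<in>K. I \<subseteq> L \<and> I \<cdot> I = {\<zero>}}"
      have "card K1 \<le> n"
      proof -
        define f where "f = (\<lambda>I. SOME x. x \<in> I - L)"
        have f: "f I \<in> I" "f I \<notin> L" if "I \<in> K1" for I
          using someI_ex[of "\<lambda>x. x \<in> I - L"] that by (auto simp: f_def K1_def)
        have fC: "f I \<in> carrier R" if "I \<in> K1" for I
          using f(1)[OF that] ideal.Icarr[OF Ki] that by (auto simp: K1_def)
        have mult: "f I \<otimes> f J = \<zero>" if IJ: "I \<in> K1" "J \<in> K1" "I \<noteq> J" for I J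
          using orth[of I J] ideal_prod_eq_zero_iff[of I J] Ki f(1) IJ by (auto simp: K1_def)
        have non_nil: "f I [^] k \<noteq> \<zero>" if "I \<in> K1" for I and k :: nat
          using nil[OF fC[OF that]] f(2)[OF that] by auto
        \<comment> \<open>An element chosen from two distinct members would have square zero.\<close>
        have inj: "inj_on f K1"
        proof (rule inj_onI, rule ccontr)
          fix I J assume IJ: "I \<in> K1" "J \<in> K1" "f I = f J" "I \<noteq> J"
          then have "f I [^] (2::nat) = \<zero>"
            using mult[of I J] fC[of J] by (simp add: numeral_2_eq_2)
          then show False using non_nil[OF IJ(1)] by auto
        qed
        have "card (f ` K1) \<le> n"
          using K(2) fC mult non_nil
          by (intro n) (auto simp: orthogonal_non_nilpotents_def K1_def)
        then show ?thesis using card_image[OF inj] by simp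
      qed
      moreover have "card K2 \<le> \<rho> L"
        by (rule square_nonzero_clique_bound[OF \<rho> L(1)]) (use K(2) Ki orth in \<open>auto simp: K2_def\<close>)
      moreover have "card K3 \<le> b"
      proof (rule square_zero_clique_bound[OF L(1) b sq])
        show "I \<cdot> J = {\<zero>}" if "I \<in> K3" "J \<in> K3" for I J
          using that orth[of I J] by (cases "I = J") (auto simp: K3_def)
      qed (use Ki in \<open>auto simp: K3_def\<close>)
      moreover have "K = K1 \<union> (K2 \<union> K3)"
        by (auto simp: K1_def K2_def K3_def)
      then have "card K \<le> card K1 + (card K2 + card K3)"
        using card_Un_le[of K1 "K2 \<union> K3"] card_Un_le[of K2 K3] by simp
      ultimately show ?thesis by linarith
    qed
    then show "\<exists>n. \<forall>K. K \<subseteq> AG_verts R \<longrightarrow> finite K \<longrightarrow> clique K (AG_edges R) \<longrightarrow> card K \<le> n"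
      by blast
  qed
  then show ?thesis
    unfolding clique_number_finite_iff using submod by auto
qed

end
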